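(* Let $q\ge0$ be an integer and let $G$ be a polycyclic group given by a consistent polycyclic presentation. Let $\nu^q(G)=F_m/S$ be a finite presentation of $\nu^q(G)$ (with $F_m$ free of rank $m$), let $\psi:\nu^q(G)\to\tau^q(G)$ be the epimorphism described in the context, let $K/S=\operatorname{Ker}\psi$, and put $$\mathfrak E^q(\tau^q(G))=\frac{F_m}{K^q[K,F_m]S}.$$ Then $\nu^q(G)=\mathfrak E^q(\tau^q(G))$ (as quotients of $F_m$).
   Context: Conventions: $y^x=x^{-1}yx$, $[x,y]=x^{-1}y^{-1}xy$; maps are written on the right. $X^q$ denotes the subgroup generated by the $q$-th powers of elements of a group $X$ (trivial if $q=0$). The construction $\mathfrak E^q$. If $\xi:H\to T$ is an epimorphism from a finitely presented group $H=F_m/S$ onto a polycyclic group $T$ given by a consistent polycyclic presentation, and $K/S=\operatorname{Ker}\xi$, then $\mathfrak E^q(T):=F_m/K^q[K,F_m]S$. Here it is applied to $T=\tau^q(G)$, $H=\nu^q(G)$, $\xi=\psi$. Polycyclic presentations. A polycyclic presentation on $g_1,\dots,g_n$ with index set $I\subseteq\{1,\dots,n\}$ has relations of the form $g_i^{e_i}=g_{i+1}^{\alpha_{i,i+1}}\cdots g_n^{\alpha_{i,n}}$ for $i\in I$; $g_j^{-1}g_ig_j=g_{j+1}^{\beta_{i,j,j+1}}\cdots g_n^{\beta_{i,j,n}}$ for $j<i$; $g_jg_ig_j^{-1}=g_{j+1}^{\gamma_{i,j,j+1}}\cdots g_n^{\gamma_{i,j,n}}$ for $j<i$, $j\notin I$,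 with $e_i\in\mathbb N$ and other exponents integers. It is consistent if every element is uniquely of the form $g_1^{a_1}\cdots g_n^{a_n}$ with $a_i\in\mathbb Z$, $0\le a_i<e_i$ for $i\in I$. Let $G=\langle g_1,\dots,g_n\mid r_1,\dots,r_l\rangle$ be the given such presentation. The group $\nu^q(G)$. Let $G^\varphi$ be an isomorphic copy of $G$ via $\varphi:g\mapsto g^\varphi$, and $\nu(G)=\langle G\cup G^\varphi\mid[g,h^\varphi]^k=[g^k,(h^k)^\varphi]=[g,h^\varphi]^{k^\varphi},\ \forall g,h,k\in G\rangle$ (where the multiplication relations of $G$ and $G^\varphi$ are understood). For $q\ge1$ let $\widehat{\mathcal G}=\{\widehat k\mid k\in G\}$ be a set of symbols (empty for $q=0$). Then $\nu^q(G)$ is the quotient of $\nu(G)*F(\widehat{\mathcal G})$ ($F(\widehat{\mathcal G})$ free on $\widehat{\mathcal G}$) by the relations, for all $g,h,k,k_1\in G$: $g^{-1}\widehat kg=\widehat{k^g}$; $(g^\varphi)^{-1}\widehat kg^\varphi=\widehat{k^g}$; $\widehat k^{-1}[g,h^\varphi]\widehat k=[g^{k^q},(h^{k^q})^\varphi]$; $\widehat k^{-1}\,\widehat{kk_1}\,\widehat{k_1}^{-1}=\prod_{i=1}^{q-1}[k,(k_1^{-i})^\varphi]^{k^{q-1-i}}$; $[\widehat k,\widehat{k_1}]=[k^q,(k_1^q)^\varphi]$; $\widehat{[g,h]}=[g,h^\varphi]^q$. The $q$-exterior square. For $q\ge1$, $G\otimes^qG$ is the group generated by symbols $g\otimes h$,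 $\widehat k$ ($g,h,k\in G$) subject to, for all $g,g_1,h,h_1,k,k_1\in G$: (1) $g\otimes hh_1=(g\otimes h_1)(g^{h_1}\otimes h^{h_1})$; (2) $gg_1\otimes h=(g^{g_1}\otimes h^{g_1})(g_1\otimes h)$; (3) $(g\otimes h)^{\widehat k}=g^{k^q}\otimes h^{k^q}$; (4) $\widehat{kk_1}=\widehat k\prod_{i=1}^{q-1}(k\otimes k_1^{-i})^{k^{q-1-i}}\widehat{k_1}$, where $(g\otimes h)^x=g^x\otimes h^x$; (5) $[\widehat k,\widehat{k_1}]=k^q\otimes k_1^q$; (6) $\widehat{[g,h]}=(g\otimes h)^q$. For $q=0$ there are no symbols $\widehat k$ (read $\widehat k$ as $1$) and only relations (1), (2). Then $G\wedge^qG=(G\otimes^qG)/\langle g\otimes g\mid g\in G\rangle$, with $g\wedge h$ and $\widehat k$ denoting images. $G$ acts on it by $(g\wedge h)^x=g^x\wedge h^x$, $(\widehat k)^x=\widehat{k^x}$. Let $\lambda:G\times G\times G\to G\wedge^qG$, $(g,h,k)\lambda=(g\wedge h)\widehat k$. The group $\tau^q(G)$. Let $\langle w_1,\dots,w_r\mid u_1,\dots,u_s\rangle$ be a consistent polycyclic presentation of $G\wedge^qG$. Then $\tau^q(G)$ is the group with generators $g_1,\dots,g_n,g_1^\varphi,\dots,g_n^\varphi,w_1,\dots,w_r$ and relations: $r_i(g_1,\dots,g_n)=1$ and $r_i(g_1^\varphi,\dots,g_n^\varphi)=1$ ($1\le i\le l$); $u_i(w_1,\dots,w_r)=1$ ($1\le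 i\le s$); $g_i^{-1}g_j^\varphi g_i=g_j^\varphi((g_i,g_j,1)\lambda)^{-1}$ ($1\le i,j\le n$); $g_ig_j^\varphi g_i^{-1}=g_j^\varphi((g_i^{-1},g_j,1)\lambda)^{-1}$ ($1\le i,j\le n$, $i\notin I$); $g_j^{-1}w_ig_j=w_i^{g_j}$ and $(g_j^\varphi)^{-1}w_ig_j^\varphi=w_i^{g_j}$ ($1\le i\le r$, $1\le j\le n$); $g_jw_ig_j^{-1}=w_i^{g_j^{-1}}$ and $g_j^\varphi w_i(g_j^\varphi)^{-1}=w_i^{g_j^{-1}}$ ($1\le i\le r$, $1\le j\le n$, $j\notin I$); values of $\lambda$ and the images $w_i^g$ under the action of $g\in G$ on $G\wedge^qG$ are written as words in $w_1,\dots,w_r$. This presentation is a consistent polycyclic presentation. The epimorphism $\psi:\nu^q(G)\to\tau^q(G)$ is the homomorphism determined by $(g_i)\psi=g_i$, $(g_i^\varphi)\psi=g_i^\varphi$ ($1\le i\le n$) and $(\widehat k)\psi=(1,1,k)\lambda$ ($k\in G$); its kernel is $\Delta^q(G)=\langle[g,g^\varphi]\mid g\in G\rangle$. *)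

theory Defs
  imports "HOL-Algebra.Generated_Groups"
begin

text \<open>Throughout, \<open>y\<^sup>x = x\<^sup>-\<^sup>1 y x\<close> and \<open>[x, y] = x\<^sup>-\<^sup>1 y\<^sup>-\<^sup>1 x y\<close>.\<close>

definition gconj :: "('a, 'b) monoid_scheme \<Rightarrow> 'a \<Rightarrow> 'a \<Rightarrow> 'a" where
  "gconj G y x = inv\<^bsub>G\<^esub> x \<otimes>\<^bsub>G\<^esub> y \<otimes>\<^bsub>G\<^esub> x"

definition gcomm :: "('a, 'b) monoid_scheme \<Rightarrow> 'a \<Rightarrow> 'a \<Rightarrow> 'a" where
  "gcomm G x y = inv\<^bsub>G\<^esub> x \<otimes>\<^bsub>G\<^esub> inv\<^bsub>G\<^esub> y \<otimes>\<^bsub>G\<^esub> x \<otimes>\<^bsub>G\<^esub> y"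

definition normal_closure :: "('a, 'b) monoid_scheme \<Rightarrow> 'a set \<Rightarrow> 'a set" where
  "normal_closure G R = \<Inter>{N. normal N G \<and> R \<subseteq> N}"

text \<open>For \<open>q = 0\<close> this is the trivial subgroup.\<close>

definition power_subgroup :: "('a, 'b) monoid_scheme \<Rightarrow> nat \<Rightarrow> 'a set \<Rightarrow> 'a set" where
  "power_subgroup G q X = generate G ((\<lambda>x. x [^]\<^bsub>G\<^esub> q) ` X)"

definition comm_subgroup :: "('a, 'b) monoid_scheme \<Rightarrow> 'a set \<Rightarrow> 'a set \<Rightarrow> 'a set" where
  "comm_subgroup G X Y = generate G {gcomm G x y | x y. x \<in> X \<and> y \<in> Y}"


section \<open>Words, free groups and presentations\<close>

text \<open>The letter \<open>(x, True)\<close> stands for \<open>x\<close> and \<open>(x, False)\<close> for \<open>x\<^sup>-\<^sup>1\<close>.\<close>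

type_synonym 'x gword = "('x \<times> bool) list"

definition words :: "'x set \<Rightarrow> 'x gword set" where
  "words X = lists (X \<times> UNIV)"

definition gen :: "'x \<Rightarrow> 'x gword" where
  "gen x = [(x, True)]"

definition winv :: "'x gword \<Rightarrow> 'x gword" where
  "winv w = rev (map (\<lambda>(x, b). (x, \<not> b)) w)"

definition wconj :: "'x gword \<Rightarrow> 'x gword \<Rightarrow> 'x gword" where
  "wconj y x = winv x @ y @ x"

definition wcomm :: "'x gword \<Rightarrow> 'x gword \<Rightarrow> 'x gword" where
  "wcomm x y = winv x @ winv y @ x @ y"

definition wpow :: "'x gword \<Rightarrow> nat \<Rightarrow> 'x gword" where
  "wpow w k = concat (replicate k w)"

definition gen_pow :: "'x \<Rightarrow> int \<Rightarrow> 'x gword" where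
  "gen_pow x a = replicate (nat \<bar>a\<bar>) (x, 0 \<le> a)"

definition wsubst :: "('x \<Rightarrow> 'y) \<Rightarrow> 'x gword \<Rightarrow> 'y gword" where
  "wsubst f = map (map_prod f id)"

fun weval :: "('a, 'b) monoid_scheme \<Rightarrow> ('x \<Rightarrow> 'a) \<Rightarrow> 'x gword \<Rightarrow> 'a" where
  "weval G f [] = \<one>\<^bsub>G\<^esub>"
| "weval G f ((x, b) # w) = (if b then f x else inv\<^bsub>G\<^esub> (f x)) \<otimes>\<^bsub>G\<^esub> weval G f w"

inductive cancels :: "'x gword \<Rightarrow> 'x gword \<Rightarrow> bool" where
  "cancels (u @ [(x, b), (x, \<not> b)] @ v) (u @ v)"

definition fclass :: "'x gword \<Rightarrow> 'x gword set" where
  "fclass w = {v. equivclp cancels w v}"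

text \<open>Cancellation classes are formed among all words over the type, so the free group on
  \<open>X\<close> appears as the subgroup generated by \<open>X\<close> in the free group on the whole type.\<close>

definition free_group :: "'x set \<Rightarrow> 'x gword set monoid" where
  "free_group X =
     \<lparr>carrier = fclass ` words X,
      mult = (\<lambda>A B. {w. \<exists>u\<in>A. \<exists>v\<in>B. equivclp cancels (u @ v) w}),
      one = fclass []\<rparr>"

text \<open>Defining relations are pairs of words; the pair \<open>(u, v)\<close> stands for \<open>u = v\<close>.\<close>

definition relators :: "('x gword \<times> 'x gword) set \<Rightarrow> 'x gword set set" where
  "relators R = (\<lambda>(u, v). fclass (u @ winv v)) ` R"

definition presented_group ::
    "'x set \<Rightarrow> ('x gword \<times> 'x gword) set \<Rightarrow> 'x gword set set monoid" where
  "presented_group X R = free_group X Mod normal_closure (free_group X) (relators R)"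

definition pres_elt ::
    "'x set \<Rightarrow> ('x gword \<times> 'x gword) set \<Rightarrow> 'x gword \<Rightarrow> 'x gword set set" where
  "pres_elt X R w =
     normal_closure (free_group X) (relators R) #>\<^bsub>free_group X\<^esub> fclass w"

text \<open>The group \<open>G\<close>, with elements \<open>a x\<close> for \<open>x \<in> X\<close>, is presented by \<open>\<langle>X | R\<rangle>\<close>.\<close>

definition has_presentation ::
    "('a, 'b) monoid_scheme \<Rightarrow> ('x \<Rightarrow> 'a) \<Rightarrow> 'x set \<Rightarrow> ('x gword \<times> 'x gword) set \<Rightarrow> bool" where
  "has_presentation G a X R \<longleftrightarrow>
     group G \<and> (\<exists>h \<in> iso (presented_group X R) G. \<forall>x\<in>X. h (pres_elt X R (gen x)) = a x)"

text \<open>The homomorphism \<open>E \<rightarrow> H\<close> determined by \<open>a x \<mapsto> b x\<close>, where \<open>a ` X\<close> generates \<open>E\<close>: write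
  the argument as a word in the \<open>a x\<close> and substitute. The choice of the word is immaterial
  whenever such a homomorphism exists.\<close>

definition hom_on_gens ::
    "('e, 'f) monoid_scheme \<Rightarrow> 'x set \<Rightarrow> ('x \<Rightarrow> 'e) \<Rightarrow> ('h, 'k) monoid_scheme \<Rightarrow> ('x \<Rightarrow> 'h)
      \<Rightarrow> 'e \<Rightarrow> 'h" where
  "hom_on_gens E X a H b y = weval H b (SOME w. w \<in> words X \<and> weval E a w = y)"

lemma weval_closed:
  assumes "group G" "f ` X \<subseteq> carrier G" "w \<in> words X"
  shows "weval G f w \<in> carrier G"
proof -
  interpret group G by fact
  show ?thesis
    using assms(3,2) unfolding words_def by (induction w rule: lists.induct) auto
qed

lemma hom_weval:
  assumes "group E" "group H" "h \<in> hom E H" "a ` X \<subseteq> carrier E" "\<And>x. x \<in> X \<Longrightarrow> h (a x) = b x"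
    and "w \<in> words X"
  shows "h (weval E a w) = weval H b w"
proof -
  interpret group_hom E H h
    using assms(1-3) by (simp add: group_hom_def group_hom_axioms_def)
  show ?thesis
    using assms(6) unfolding words_def
  proof (induction w rule: lists.induct)
    case (Cons l w)
    obtain x c where l: "l = (x, c)" "x \<in> X" using Cons.hyps(1) by auto
    have "a x \<in> carrier E" using l(2) assms(4) by auto
    moreover have "weval E a w \<in> carrier E"
      using weval_closed[OF assms(1,4)] Cons.hyps(2) by (simp add: words_def)
    ultimately show ?case using l Cons.IH assms(5) by auto
  qed simp
qed

lemma hom_on_gens_eq:
  assumes "group E" "group H" "h \<in> hom E H" "a ` X \<subseteq> carrier E" "\<And>x. x \<in> X \<Longrightarrow> h (a x) = b x"
    and "\<exists>w \<in> words X. weval E a w = y"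
  shows "hom_on_gens E X a H b y = h y"
proof -
  let ?w = "SOME w. w \<in> words X \<and> weval E a w = y"
  have "?w \<in> words X \<and> weval E a ?w = y"
    by (rule someI_ex) (use assms(6) in blast)
  then show ?thesis
    using hom_weval[OF assms(1-5), of ?w] by (simp add: hom_on_gens_def)
qed


section \<open>Consistent polycyclic presentations\<close>

text \<open>The generators are indexed by \<open>{1..pc_len P}\<close>; \<open>pc_fin P\<close> is the index set \<open>I\<close> and the
  remaining fields are the exponents \<open>e\<^sub>i\<close>, \<open>\<alpha>\<^sub>i\<^sub>,\<^sub>k\<close>, \<open>\<beta>\<^sub>i\<^sub>,\<^sub>j\<^sub>,\<^sub>k\<close>, \<open>\<gamma>\<^sub>i\<^sub>,\<^sub>j\<^sub>,\<^sub>k\<close>.\<close>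

record pc_pres =
  pc_len :: nat
  pc_fin :: "nat set"
  pc_exp :: "nat \<Rightarrow> nat"
  pc_alpha :: "nat \<Rightarrow> nat \<Rightarrow> int"
  pc_beta :: "nat \<Rightarrow> nat \<Rightarrow> nat \<Rightarrow> int"
  pc_gamma :: "nat \<Rightarrow> nat \<Rightarrow> nat \<Rightarrow> int"

definition pc_word :: "nat \<Rightarrow> nat \<Rightarrow> (nat \<Rightarrow> int) \<Rightarrow> nat gword" where
  "pc_word lo hi a = concat (map (\<lambda>k. gen_pow k (a k)) [lo..<Suc hi])"

inductive_set pc_rels :: "pc_pres \<Rightarrow> (nat gword \<times> nat gword) set" for P where
  pc_power: "i \<in> pc_fin P \<Longrightarrow>
    (wpow (gen i) (pc_exp P i), pc_word (Suc i) (pc_len P) (pc_alpha P i)) \<in> pc_rels P"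
| pc_conj: "\<lbrakk>1 \<le> j; j < i; i \<le> pc_len P\<rbrakk> \<Longrightarrow>
    (winv (gen j) @ gen i @ gen j, pc_word (Suc j) (pc_len P) (pc_beta P i j)) \<in> pc_rels P"
| pc_conj_inv: "\<lbrakk>1 \<le> j; j < i; i \<le> pc_len P; j \<notin> pc_fin P\<rbrakk> \<Longrightarrow>
    (gen j @ gen i @ winv (gen j), pc_word (Suc j) (pc_len P) (pc_gamma P i j)) \<in> pc_rels P"

definition pc_exponents :: "pc_pres \<Rightarrow> (nat \<Rightarrow> int) set" where
  "pc_exponents P = {a \<in> {1..pc_len P} \<rightarrow>\<^sub>E UNIV.
     \<forall>i \<in> pc_fin P. 0 \<le> a i \<and> a i < int (pc_exp P i)}"

definition consistent_pc_presentation ::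
    "('a, 'b) monoid_scheme \<Rightarrow> (nat \<Rightarrow> 'a) \<Rightarrow> pc_pres \<Rightarrow> bool" where
  "consistent_pc_presentation G g P \<longleftrightarrow>
     pc_fin P \<subseteq> {1..pc_len P} \<and> (\<forall>i \<in> pc_fin P. 0 < pc_exp P i) \<and>
     has_presentation G g {1..pc_len P} (pc_rels P) \<and>
     (\<forall>x \<in> carrier G. \<exists>!a. a \<in> pc_exponents P \<and> weval G g (pc_word 1 (pc_len P) a) = x)"


section \<open>The group \<open>\<nu>\<^sup>q(G)\<close>\<close>

datatype 'a nu_gen = El 'a | Ph 'a | NHat 'a

definition nu_gens :: "nat \<Rightarrow> ('a, 'b) monoid_scheme \<Rightarrow> 'a nu_gen set" where
  "nu_gens q G =
     El ` carrier G \<union> Ph ` carrier G \<union> (if q = 0 then {} else NHat ` carrier G)"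

text \<open>\<open>El g\<close>, \<open>Ph g\<close> and \<open>NHat k\<close> stand for \<open>g\<close>, \<open>g\<^sup>\<phi>\<close> and the symbol \<open>k\<close> with a hat. The first four
  rules, on the generators \<open>El g\<close> and \<open>Ph g\<close>, present \<open>\<nu>(G)\<close>; adding the free generators
  \<open>NHat k\<close> gives the free product of \<open>\<nu>(G)\<close> with the free group on the hat symbols.\<close>

inductive_set nu_rels :: "nat \<Rightarrow> ('a, 'b) monoid_scheme \<Rightarrow> ('a nu_gen gword \<times> 'a nu_gen gword) set"
  for q G where
  mult_El: "\<lbrakk>g \<in> carrier G; h \<in> carrier G\<rbrakk> \<Longrightarrow>
    (gen (El g) @ gen (El h), gen (El (g \<otimes>\<^bsub>G\<^esub> h))) \<in> nu_rels q G"
| mult_Ph: "\<lbrakk>g \<in> carrier G; h \<in> carrier G\<rbrakk> \<Longrightarrow>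
    (gen (Ph g) @ gen (Ph h), gen (Ph (g \<otimes>\<^bsub>G\<^esub> h))) \<in> nu_rels q G"
| comm_conj_El: "\<lbrakk>g \<in> carrier G; h \<in> carrier G; k \<in> carrier G\<rbrakk> \<Longrightarrow>
    (wconj (wcomm (gen (El g)) (gen (Ph h))) (gen (El k)),
     wcomm (gen (El (gconj G g k))) (gen (Ph (gconj G h k)))) \<in> nu_rels q G"
| comm_conj_Ph: "\<lbrakk>g \<in> carrier G; h \<in> carrier G; k \<in> carrier G\<rbrakk> \<Longrightarrow>
    (wcomm (gen (El (gconj G g k))) (gen (Ph (gconj G h k))),
     wconj (wcomm (gen (El g)) (gen (Ph h))) (gen (Ph k))) \<in> nu_rels q G"
| hat_conj_El: "\<lbrakk>0 < q; g \<in> carrier G; k \<in> carrier G\<rbrakk> \<Longrightarrow>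
    (winv (gen (El g)) @ gen (NHat k) @ gen (El g), gen (NHat (gconj G k g))) \<in> nu_rels q G"
| hat_conj_Ph: "\<lbrakk>0 < q; g \<in> carrier G; k \<in> carrier G\<rbrakk> \<Longrightarrow>
    (winv (gen (Ph g)) @ gen (NHat k) @ gen (Ph g), gen (NHat (gconj G k g))) \<in> nu_rels q G"
| comm_conj_hat: "\<lbrakk>0 < q; g \<in> carrier G; h \<in> carrier G; k \<in> carrier G\<rbrakk> \<Longrightarrow>
    (winv (gen (NHat k)) @ wcomm (gen (El g)) (gen (Ph h)) @ gen (NHat k),
     wcomm (gen (El (gconj G g (k [^]\<^bsub>G\<^esub> q)))) (gen (Ph (gconj G h (k [^]\<^bsub>G\<^esub> q))))) \<in> nu_rels q G"
| hat_mult: "\<lbrakk>0 < q; k \<in> carrier G; k1 \<in> carrier G\<rbrakk> \<Longrightarrow>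
    (winv (gen (NHat k)) @ gen (NHat (k \<otimes>\<^bsub>G\<^esub> k1)) @ winv (gen (NHat k1)),
     concat (map (\<lambda>i. wconj (wcomm (gen (El k)) (gen (Ph (k1 [^]\<^bsub>G\<^esub> (- int i)))))
                            (gen (El (k [^]\<^bsub>G\<^esub> (q - 1 - i))))) [1..<q])) \<in> nu_rels q G"
| hat_comm: "\<lbrakk>0 < q; k \<in> carrier G; k1 \<in> carrier G\<rbrakk> \<Longrightarrow>
    (wcomm (gen (NHat k)) (gen (NHat k1)),
     wcomm (gen (El (k [^]\<^bsub>G\<^esub> q))) (gen (Ph (k1 [^]\<^bsub>G\<^esub> q)))) \<in> nu_rels q G"
| hat_of_comm: "\<lbrakk>0 < q; g \<in> carrier G; h \<in> carrier G\<rbrakk> \<Longrightarrow>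
    (gen (NHat (gcomm G g h)), wpow (wcomm (gen (El g)) (gen (Ph h))) q) \<in> nu_rels q G"

definition nu :: "nat \<Rightarrow> ('a, 'b) monoid_scheme \<Rightarrow> 'a nu_gen gword set set monoid" where
  "nu q G = presented_group (nu_gens q G) (nu_rels q G)"

definition nu_elt :: "nat \<Rightarrow> ('a, 'b) monoid_scheme \<Rightarrow> 'a nu_gen \<Rightarrow> 'a nu_gen gword set set" where
  "nu_elt q G x = pres_elt (nu_gens q G) (nu_rels q G) (gen x)"


section \<open>The \<open>q\<close>-tensor square and the \<open>q\<close>-exterior square\<close>

datatype 'a tens_gen = Tens 'a 'a | THat 'a

definition tens_gens :: "nat \<Rightarrow> ('a, 'b) monoid_scheme \<Rightarrow> 'a tens_gen set" where
  "tens_gens q G =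
     {Tens g h | g h. g \<in> carrier G \<and> h \<in> carrier G} \<union> (if q = 0 then {} else THat ` carrier G)"

text \<open>\<open>(g \<otimes> h)\<^sup>x = g\<^sup>x \<otimes> h\<^sup>x\<close>, and \<open>k\<^sup>x\<close> under the hat, on generators.\<close>

fun tens_act :: "('a, 'b) monoid_scheme \<Rightarrow> 'a \<Rightarrow> 'a tens_gen \<Rightarrow> 'a tens_gen" where
  "tens_act G x (Tens g h) = Tens (gconj G g x) (gconj G h x)"
| "tens_act G x (THat k) = THat (gconj G k x)"

inductive_set tens_rels ::
    "nat \<Rightarrow> ('a, 'b) monoid_scheme \<Rightarrow> ('a tens_gen gword \<times> 'a tens_gen gword) set" for q G where
  tens_right: "\<lbrakk>g \<in> carrier G; h \<in> carrier G; h1 \<in> carrier G\<rbrakk> \<Longrightarrow>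
    (gen (Tens g (h \<otimes>\<^bsub>G\<^esub> h1)),
     gen (Tens g h1) @ gen (Tens (gconj G g h1) (gconj G h h1))) \<in> tens_rels q G"
| tens_left: "\<lbrakk>g \<in> carrier G; g1 \<in> carrier G; h \<in> carrier G\<rbrakk> \<Longrightarrow>
    (gen (Tens (g \<otimes>\<^bsub>G\<^esub> g1) h),
     gen (Tens (gconj G g g1) (gconj G h g1)) @ gen (Tens g1 h)) \<in> tens_rels q G"
| tens_conj_hat: "\<lbrakk>0 < q; g \<in> carrier G; h \<in> carrier G; k \<in> carrier G\<rbrakk> \<Longrightarrow>
    (wconj (gen (Tens g h)) (gen (THat k)),
     gen (Tens (gconj G g (k [^]\<^bsub>G\<^esub> q)) (gconj G h (k [^]\<^bsub>G\<^esub> q)))) \<in> tens_rels q G"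
| tens_hat_mult: "\<lbrakk>0 < q; k \<in> carrier G; k1 \<in> carrier G\<rbrakk> \<Longrightarrow>
    (gen (THat (k \<otimes>\<^bsub>G\<^esub> k1)),
     gen (THat k) @
     concat (map (\<lambda>i. gen (tens_act G (k [^]\<^bsub>G\<^esub> (q - 1 - i)) (Tens k (k1 [^]\<^bsub>G\<^esub> (- int i))))) [1..<q]) @
     gen (THat k1)) \<in> tens_rels q G"
| tens_hat_comm: "\<lbrakk>0 < q; k \<in> carrier G; k1 \<in> carrier G\<rbrakk> \<Longrightarrow>
    (wcomm (gen (THat k)) (gen (THat k1)),
     gen (Tens (k [^]\<^bsub>G\<^esub> q) (k1 [^]\<^bsub>G\<^esub> q))) \<in> tens_rels q G"
| tens_hat_of_comm: "\<lbrakk>0 < q; g \<in> carrier G; h \<in> carrier G\<rbrakk> \<Longrightarrow>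
    (gen (THat (gcomm G g h)), wpow (gen (Tens g h)) q) \<in> tens_rels q G"

definition tens_sq :: "nat \<Rightarrow> ('a, 'b) monoid_scheme \<Rightarrow> 'a tens_gen gword set set monoid" where
  "tens_sq q G = presented_group (tens_gens q G) (tens_rels q G)"

definition tens_elt ::
    "nat \<Rightarrow> ('a, 'b) monoid_scheme \<Rightarrow> 'a tens_gen \<Rightarrow> 'a tens_gen gword set set" where
  "tens_elt q G x = pres_elt (tens_gens q G) (tens_rels q G) (gen x)"

definition diag_sub :: "nat \<Rightarrow> ('a, 'b) monoid_scheme \<Rightarrow> 'a tens_gen gword set set set" where
  "diag_sub q G = generate (tens_sq q G) ((\<lambda>g. tens_elt q G (Tens g g)) ` carrier G)"

definition ext_sq :: "nat \<Rightarrow> ('a, 'b) monoid_scheme \<Rightarrow> 'a tens_gen gword set set set monoid" where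
  "ext_sq q G = tens_sq q G Mod diag_sub q G"

definition ext_elt ::
    "nat \<Rightarrow> ('a, 'b) monoid_scheme \<Rightarrow> 'a tens_gen \<Rightarrow> 'a tens_gen gword set set set" where
  "ext_elt q G x = diag_sub q G #>\<^bsub>tens_sq q G\<^esub> tens_elt q G x"

definition wedge ::
    "nat \<Rightarrow> ('a, 'b) monoid_scheme \<Rightarrow> 'a \<Rightarrow> 'a \<Rightarrow> 'a tens_gen gword set set set" where
  "wedge q G g h = ext_elt q G (Tens g h)"

definition ext_hat ::
    "nat \<Rightarrow> ('a, 'b) monoid_scheme \<Rightarrow> 'a \<Rightarrow> 'a tens_gen gword set set set" where
  "ext_hat q G k = (if q = 0 then \<one>\<^bsub>ext_sq q G\<^esub> else ext_elt q G (THat k))"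

definition lam ::
    "nat \<Rightarrow> ('a, 'b) monoid_scheme \<Rightarrow> 'a \<Rightarrow> 'a \<Rightarrow> 'a \<Rightarrow> 'a tens_gen gword set set set" where
  "lam q G g h k = wedge q G g h \<otimes>\<^bsub>ext_sq q G\<^esub> ext_hat q G k"

definition ext_act ::
    "nat \<Rightarrow> ('a, 'b) monoid_scheme \<Rightarrow> 'a \<Rightarrow> 'a tens_gen gword set set set
      \<Rightarrow> 'a tens_gen gword set set set" where
  "ext_act q G x =
     hom_on_gens (ext_sq q G) (tens_gens q G) (ext_elt q G) (ext_sq q G)
       (\<lambda>t. ext_elt q G (tens_act G x t))"


section \<open>The group \<open>\<tau>\<^sup>q(G)\<close>\<close>

datatype tau_gen = TG nat | TPh nat | TW nat

text \<open>\<open>P\<close> is the presentation of \<open>G\<close> on \<open>g 1, \<dots>, g n\<close> and \<open>Q\<close> that of the exterior square on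
  \<open>w 1, \<dots>, w r\<close>; \<open>wd\<close> assigns to an element of the exterior square a word in \<open>w 1, \<dots>, w r\<close>
  representing it.\<close>

definition tau_gens :: "pc_pres \<Rightarrow> pc_pres \<Rightarrow> tau_gen set" where
  "tau_gens P Q = TG ` {1..pc_len P} \<union> TPh ` {1..pc_len P} \<union> TW ` {1..pc_len Q}"

inductive_set tau_rels ::
    "nat \<Rightarrow> ('a, 'b) monoid_scheme \<Rightarrow> (nat \<Rightarrow> 'a) \<Rightarrow> pc_pres
      \<Rightarrow> (nat \<Rightarrow> 'a tens_gen gword set set set) \<Rightarrow> pc_pres
      \<Rightarrow> ('a tens_gen gword set set set \<Rightarrow> nat gword) \<Rightarrow> (tau_gen gword \<times> tau_gen gword) set"
  for q G g P w Q wd where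
  rel_G: "(u, v) \<in> pc_rels P \<Longrightarrow> (wsubst TG u, wsubst TG v) \<in> tau_rels q G g P w Q wd"
| rel_Gphi: "(u, v) \<in> pc_rels P \<Longrightarrow> (wsubst TPh u, wsubst TPh v) \<in> tau_rels q G g P w Q wd"
| rel_ext: "(u, v) \<in> pc_rels Q \<Longrightarrow> (wsubst TW u, wsubst TW v) \<in> tau_rels q G g P w Q wd"
| conj_Gphi: "\<lbrakk>i \<in> {1..pc_len P}; j \<in> {1..pc_len P}\<rbrakk> \<Longrightarrow>
    (winv (gen (TG i)) @ gen (TPh j) @ gen (TG i),
     gen (TPh j) @ winv (wsubst TW (wd (lam q G (g i) (g j) \<one>\<^bsub>G\<^esub>)))) \<in> tau_rels q G g P w Q wd"
| conj_Gphi_inv: "\<lbrakk>i \<in> {1..pc_len P}; j \<in> {1..pc_len P}; i \<notin> pc_fin P\<rbrakk> \<Longrightarrow>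
    (gen (TG i) @ gen (TPh j) @ winv (gen (TG i)),
     gen (TPh j) @ winv (wsubst TW (wd (lam q G (inv\<^bsub>G\<^esub> g i) (g j) \<one>\<^bsub>G\<^esub>)))) \<in> tau_rels q G g P w Q wd"
| conj_ext_G: "\<lbrakk>i \<in> {1..pc_len Q}; j \<in> {1..pc_len P}\<rbrakk> \<Longrightarrow>
    (winv (gen (TG j)) @ gen (TW i) @ gen (TG j),
     wsubst TW (wd (ext_act q G (g j) (w i)))) \<in> tau_rels q G g P w Q wd"
| conj_ext_Gphi: "\<lbrakk>i \<in> {1..pc_len Q}; j \<in> {1..pc_len P}\<rbrakk> \<Longrightarrow>
    (winv (gen (TPh j)) @ gen (TW i) @ gen (TPh j),
     wsubst TW (wd (ext_act q G (g j) (w i)))) \<in> tau_rels q G g P w Q wd"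
| conj_ext_G_inv: "\<lbrakk>i \<in> {1..pc_len Q}; j \<in> {1..pc_len P}; j \<notin> pc_fin P\<rbrakk> \<Longrightarrow>
    (gen (TG j) @ gen (TW i) @ winv (gen (TG j)),
     wsubst TW (wd (ext_act q G (inv\<^bsub>G\<^esub> g j) (w i)))) \<in> tau_rels q G g P w Q wd"
| conj_ext_Gphi_inv: "\<lbrakk>i \<in> {1..pc_len Q}; j \<in> {1..pc_len P}; j \<notin> pc_fin P\<rbrakk> \<Longrightarrow>
    (gen (TPh j) @ gen (TW i) @ winv (gen (TPh j)),
     wsubst TW (wd (ext_act q G (inv\<^bsub>G\<^esub> g j) (w i)))) \<in> tau_rels q G g P w Q wd"

definition tau where
  "tau q G g P w Q wd = presented_group (tau_gens P Q) (tau_rels q G g P w Q wd)"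

definition tau_elt where
  "tau_elt q G g P w Q wd = pres_elt (tau_gens P Q) (tau_rels q G g P w Q wd)"


section \<open>The construction \<open>\<EE>\<^sup>q\<close>\<close>

text \<open>\<open>\<xi>\<close> is an epimorphism from \<open>F Mod S\<close> onto \<open>T\<close>, and \<open>K/S\<close> is its kernel.\<close>

definition ker_preimage ::
    "('a, 'b) monoid_scheme \<Rightarrow> 'a set \<Rightarrow> ('c, 'd) monoid_scheme \<Rightarrow> ('a set \<Rightarrow> 'c) \<Rightarrow> 'a set" where
  "ker_preimage F S T \<xi> = {x \<in> carrier F. S #>\<^bsub>F\<^esub> x \<in> kernel (F Mod S) T \<xi>}"

definition frakE ::
    "nat \<Rightarrow> ('a, 'b) monoid_scheme \<Rightarrow> 'a set \<Rightarrow> ('c, 'd) monoid_scheme \<Rightarrow> ('a set \<Rightarrow> 'c)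
      \<Rightarrow> 'a set monoid" where
  "frakE q F S T \<xi> =
     (let K = ker_preimage F S T \<xi>
      in F Mod (power_subgroup F q K <#>\<^bsub>F\<^esub> comm_subgroup F K (carrier F) <#>\<^bsub>F\<^esub> S))"

end

theory Submission
  imports Defs
begin

text \<open>
  Write \<open>N\<close> for \<open>\<nu>\<^sup>q(G)\<close>. Identifying \<open>F/S\<close> with \<open>N\<close>, the subgroup \<open>K\<close> is the preimage of
  \<open>Ker \<psi>\<close>, so the claim amounts to \<open>K\<^sup>q [K, F] \<subseteq> S\<close>: the kernel of \<open>\<psi>\<close> must be central in \<open>N\<close>
  and have exponent dividing \<open>q\<close>. Let \<open>Z\<close> be the subgroup of all central elements \<open>z\<close> of \<open>N\<close> with
  \<open>z\<^sup>q = 1\<close>; then \<open>Ker \<psi> \<subseteq> Z\<close> has to be shown.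

  Every \<open>[g, g\<^sup>\<phi>]\<close> lies in \<open>Z\<close> (\<open>diag_central_torsion\<close>). For centrality, expand \<open>[g, (gk)\<^sup>\<phi>]\<close>
  once as it stands and once through \<open>gk = (gkg\<^sup>-\<^sup>1)g\<close>. Since \<open>g\<close> and \<open>g\<^sup>\<phi>\<close> act in the same way on
  the elements \<open>[x, y\<^sup>\<phi>]\<close>, conjugation by \<open>[g, g\<^sup>\<phi>]\<close> fixes \<open>[g, k\<^sup>\<phi>]\<close>, and comparing both
  expansions gives \<open>[g, g\<^sup>\<phi>]\<^sup>k = [g, g\<^sup>\<phi>]\<close>. For \<open>q > 0\<close> the exponent comes from the hat
  symbols: \<open>[g, g\<^sup>\<phi>]\<^sup>q\<close> is the hat of \<open>[g, g] = 1\<close>, and the hat of \<open>1\<close> is trivial; for \<open>q = 0\<close>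
  the condition \<open>z\<^sup>q = 1\<close> is void.

  Consequently \<open>g \<and> h \<mapsto> [g, h\<^sup>\<phi>] Z\<close>, together with the map sending hats to hats, is a
  homomorphism \<open>\<mu>\<close> from the \<open>q\<close>-exterior square of \<open>G\<close> to \<open>N/Z\<close> (\<open>ext_sq_universal\<close>): the
  defining relations of the tensor square hold among these elements of \<open>N\<close>, and the elements
  \<open>g \<otimes> g\<close> die modulo \<open>Z\<close>. The relations presenting \<open>\<tau>\<^sup>q(G)\<close> only express the multiplication in
  \<open>G\<close>, in \<open>G\<^sup>\<phi>\<close> and in the exterior square, the conjugation of \<open>G\<^sup>\<phi>\<close> by \<open>G\<close>, and the action of both
  on the exterior square. All of them hold in \<open>N/Z\<close> when the \<open>w\<^sub>i\<close> are interpreted through \<open>\<mu>\<close> (\<open>tau_relation\<close>). Hence there is a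
  homomorphism \<open>\<chi>\<close> from \<open>\<tau>\<^sup>q(G)\<close> to \<open>N/Z\<close>, and \<open>\<chi> \<circ> \<psi>\<close> agrees on generators with the projection
  \<open>N \<rightarrow> N/Z\<close>. So an element killed by \<open>\<psi>\<close> lies in \<open>Z\<close> (\<open>kernel_central_torsion\<close>).
\<close>

section \<open>Words and their values\<close>

lemma words_Nil [simp]: "[] \<in> words X"
  and words_Cons [simp]: "l # w \<in> words X \<longleftrightarrow> fst l \<in> X \<and> w \<in> words X"
  and words_append [simp]: "u @ v \<in> words X \<longleftrightarrow> u \<in> words X \<and> v \<in> words X"
  and words_gen [simp]: "gen x \<in> words X \<longleftrightarrow> x \<in> X"
  by (cases l; force simp: words_def gen_def)+

lemma words_winv [simp]: "winv w \<in> words X \<longleftrightarrow> w \<in> words X"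
  by (force simp: words_def winv_def in_lists_conv_set)

lemma words_wconj [simp]: "wconj y x \<in> words X \<longleftrightarrow> x \<in> words X \<and> y \<in> words X"
  and words_wcomm [simp]: "wcomm x y \<in> words X \<longleftrightarrow> x \<in> words X \<and> y \<in> words X"
  by (auto simp: wconj_def wcomm_def)

lemma words_concat: "(\<And>w. w \<in> set ws \<Longrightarrow> w \<in> words X) \<Longrightarrow> concat ws \<in> words X"
  by (induction ws) auto

lemma words_wpow: "w \<in> words X \<Longrightarrow> wpow w k \<in> words X"
  unfolding wpow_def by (rule words_concat) auto

lemma words_wsubst: "w \<in> words X \<Longrightarrow> (\<And>x. x \<in> X \<Longrightarrow> s x \<in> Y) \<Longrightarrow> wsubst s w \<in> words Y"
  unfolding wsubst_def by (induction w) auto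

lemma winv_Nil [simp]: "winv [] = []"
  and winv_Cons: "winv (l # w) = winv w @ [(fst l, \<not> snd l)]"
  by (simp_all add: winv_def split: prod.split)

lemma words_induct [consumes 1, case_names Nil pos neg]:
  assumes "w \<in> words X" and "P []"
    and "\<And>x w. \<lbrakk>x \<in> X; w \<in> words X; P w\<rbrakk> \<Longrightarrow> P (gen x @ w)"
    and "\<And>x w. \<lbrakk>x \<in> X; w \<in> words X; P w\<rbrakk> \<Longrightarrow> P (winv (gen x) @ w)"
  shows "P w"
  using assms(1)
proof (induction w)
  case (Cons l w)
  obtain x c where l: "l = (x, c)" by fastforce
  with Cons assms(3)[of x w] assms(4)[of x w] show ?case
    by (cases c) (auto simp: gen_def winv_def)
qed (rule assms(2))

lemma weval_cong: "w \<in> words X \<Longrightarrow> (\<And>x. x \<in> X \<Longrightarrow> f x = f' x) \<Longrightarrow> weval G f w = weval G f' w"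
  by (induction w) (auto split: prod.split)

lemma weval_wsubst: "weval G f (wsubst s w) = weval G (f \<circ> s) w"
  by (induction w) (auto simp: wsubst_def)

lemma (in group) inv_cancel_left [simp]:
  "x \<in> carrier G \<Longrightarrow> y \<in> carrier G \<Longrightarrow> inv x \<otimes> (x \<otimes> y) = y"
  "x \<in> carrier G \<Longrightarrow> y \<in> carrier G \<Longrightarrow> x \<otimes> (inv x \<otimes> y) = y"
  by (simp_all flip: m_assoc)

locale letters = group G for G (structure) +
  fixes f :: "'x \<Rightarrow> 'a" and X :: "'x set"
  assumes letter_closed [simp]: "x \<in> X \<Longrightarrow> f x \<in> carrier G"
begin

lemma value_closed [simp]: "w \<in> words X \<Longrightarrow> weval G f w \<in> carrier G"
  by (rule weval_closed) auto

lemma value_gen [simp]: "x \<in> X \<Longrightarrow> weval G f (gen x) = f x"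
  by (simp add: gen_def)

lemma value_append [simp]:
  "u \<in> words X \<Longrightarrow> v \<in> words X \<Longrightarrow> weval G f (u @ v) = weval G f u \<otimes> weval G f v"
  by (induction u) (auto simp: m_assoc)

lemma value_winv [simp]: "w \<in> words X \<Longrightarrow> weval G f (winv w) = inv (weval G f w)"
  by (induction w) (auto simp: winv_Cons inv_mult_group)

lemma value_wconj [simp]:
  "x \<in> words X \<Longrightarrow> y \<in> words X \<Longrightarrow> weval G f (wconj y x) = gconj G (weval G f y) (weval G f x)"
  by (simp add: wconj_def gconj_def m_assoc)

lemma value_wcomm [simp]:
  "x \<in> words X \<Longrightarrow> y \<in> words X \<Longrightarrow> weval G f (wcomm x y) = gcomm G (weval G f x) (weval G f y)"
  by (simp add: wcomm_def gcomm_def m_assoc)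

lemma value_concat:
  "(\<And>i. i \<in> set js \<Longrightarrow> u i \<in> words X) \<Longrightarrow>
    weval G f (concat (map u js)) = foldr (\<lambda>i y. weval G f (u i) \<otimes> y) js \<one>"
proof (induction js)
  case (Cons j js)
  then have "concat (map u js) \<in> words X" by (intro words_concat) auto
  with Cons show ?case by simp
qed simp

lemma value_wpow [simp]: "w \<in> words X \<Longrightarrow> weval G f (wpow w k) = weval G f w [^] k"
proof (induction k)
  case (Suc k)
  have "wpow w (Suc k) = w @ wpow w k" by (simp add: wpow_def)
  then show ?case using Suc words_wpow[of w X k]
    by (simp only: value_append) (simp flip: nat_pow_Suc2)
qed (simp add: wpow_def)

lemma value_cancel: "cancels u v \<Longrightarrow> X = UNIV \<Longrightarrow> weval G f u = weval G f v"
  by (induction rule: cancels.induct) (auto simp: words_def m_assoc)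

end


section \<open>Free groups and presented groups\<close>

lemma cancels_context: "cancels u v \<Longrightarrow> cancels (a @ u @ b) (a @ v @ b)"
proof (induction rule: cancels.induct)
  case (1 u x c v)
  show ?case using cancels.intros[of "a @ u" x c "v @ b"] by simp
qed

lemma equiv_context:
  assumes "equivclp cancels u v"
  shows "equivclp cancels (a @ u @ b) (a @ v @ b)"
  using assms
proof (induction rule: equivclp_induct)
  case (step y z)
  then show ?case
    using cancels_context[of y z a b] cancels_context[of z y a b]
    by (blast intro: rtranclp_trans equivclp_trans r_into_equivclp converse_r_into_equivclp)
qed simp

lemma equiv_append:
  assumes "equivclp cancels u u'" "equivclp cancels v v'"
  shows "equivclp cancels (u @ v) (u' @ v')"
  using equiv_context[OF assms(1), of "[]" v] equiv_context[OF assms(2), of u' "[]"]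
  by (auto intro: equivclp_trans)

lemma fclass_eq_iff: "fclass u = fclass v \<longleftrightarrow> equivclp cancels u v"
  unfolding fclass_def by (auto intro: equivclp_trans equivclp_sym)

lemma fclass_mult [simp]: "fclass u \<otimes>\<^bsub>free_group X\<^esub> fclass v = fclass (u @ v)"
  unfolding free_group_def fclass_def
  by (auto intro: equivclp_trans equiv_append) (metis equivclp_refl)

lemma fclass_one [simp]: "\<one>\<^bsub>free_group X\<^esub> = fclass []"
  and carrier_free_group: "carrier (free_group X) = fclass ` words X"
  by (simp_all add: free_group_def)

lemma winv_cancel: "equivclp cancels (winv w @ w) []"
proof (induction w)
  case (Cons l w)
  have "cancels (winv w @ [(fst l, \<not> snd l), (fst l, \<not> \<not> snd l)] @ w) (winv w @ w)"
    by (rule cancels.intros)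
  then show ?case using Cons
    by (auto simp: winv_Cons intro: equivclp_trans r_into_equivclp)
qed simp

lemma group_free_group: "group (free_group X)"
proof (rule groupI)
  show "\<exists>y\<in>carrier (free_group X). y \<otimes>\<^bsub>free_group X\<^esub> x = \<one>\<^bsub>free_group X\<^esub>"
    if x: "x \<in> carrier (free_group X)" for x
  proof -
    obtain w where "x = fclass w" "w \<in> words X"
      using x by (auto simp: carrier_free_group)
    then show ?thesis using winv_cancel[of w]
      by (intro bexI[of _ "fclass (winv w)"]) (auto simp: carrier_free_group fclass_eq_iff)
  qed
qed (auto simp: carrier_free_group)

lemma fclass_winv: "w \<in> words X \<Longrightarrow> inv\<^bsub>free_group X\<^esub> fclass w = fclass (winv w)"
  by (rule group.inv_equality[OF group_free_group])
    (auto simp: carrier_free_group fclass_eq_iff winv_cancel)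

lemma normal_normal_closure:
  assumes "group G" "R \<subseteq> carrier G"
  shows "normal (normal_closure G R) G" and "R \<subseteq> normal_closure G R"
proof -
  interpret group G by fact
  let ?\<N> = "{N. N \<lhd> G \<and> R \<subseteq> N}"
  have ne: "carrier G \<in> ?\<N>" using assms normal_invI[OF subgroup_self] by simp
  show "normal (normal_closure G R) G"
    unfolding normal_closure_def
  proof (rule normal_invI)
    show "subgroup (\<Inter>?\<N>) G"
      using ne by (intro subgroups_Inter) (auto simp: normal_imp_subgroup)
  qed (auto intro: normal.inv_op_closed2)
  show "R \<subseteq> normal_closure G R" by (auto simp: normal_closure_def)
qed

lemma normal_closure_minimal: "N \<lhd> G \<Longrightarrow> R \<subseteq> N \<Longrightarrow> normal_closure G R \<subseteq> N"
  by (auto simp: normal_closure_def)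

text \<open>Evaluation does not change under cancellation. The representatives of a class may contain letters
  outside \<open>X\<close>, where \<open>f\<close> is arbitrary; evaluating these as \<open>\<one>\<close> makes the value independent of the
  representative.\<close>

lemma (in letters) free_group_universal:
  obtains h where "h \<in> hom (free_group X) G" "\<And>w. w \<in> words X \<Longrightarrow> h (fclass w) = weval G f w"
proof
  define f' where "f' x = (if x \<in> X then f x else \<one>)" for x
  interpret total: letters G f' UNIV by unfold_locales (simp add: f'_def)
  have inv: "weval G f' u = weval G f' v" if "equivclp cancels u v" for u v
    using that by (induction rule: equivclp_induct) (auto dest: total.value_cancel)
  let ?h = "\<lambda>A. weval G f' (SOME w. w \<in> A)"
  have h': "?h (fclass w) = weval G f' w" for w
  proof -
    have "(SOME v. v \<in> fclass w) \<in> fclass w"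
      by (rule someI[of _ w]) (simp add: fclass_def)
    then show ?thesis using inv[of w] by (simp add: fclass_def)
  qed
  then show h: "?h (fclass w) = weval G f w" if "w \<in> words X" for w
    using that weval_cong[of w X f' f] by (simp add: f'_def)
  then show "?h \<in> hom (free_group X) G"
    by (auto simp: hom_def carrier_free_group)
qed

text \<open>The condition that the relations are words in the letters is essential: the normal closure is an
  intersection of normal subgroups, and it degenerates to the whole type if a relator lies outside
  the free group on \<open>X\<close>.\<close>

locale presentation =
  fixes X :: "'x set" and R :: "('x gword \<times> 'x gword) set"
  assumes rel_words: "(u, v) \<in> R \<Longrightarrow> u \<in> words X \<and> v \<in> words X"
begin

abbreviation "elt \<equiv> pres_elt X R"

sublocale FG: group "free_group X"
  by (rule group_free_group)

lemma relators_closed: "relators R \<subseteq> carrier (free_group X)"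
  using rel_words by (auto simp: relators_def carrier_free_group)

sublocale NC: normal "normal_closure (free_group X) (relators R)" "free_group X"
  by (rule normal_normal_closure[OF group_free_group relators_closed])

lemma group_presented: "group (presented_group X R)"
  unfolding presented_group_def by (rule NC.factorgroup_is_group)

lemma presented_carrier: "carrier (presented_group X R) = elt ` words X"
  by (auto simp: presented_group_def pres_elt_def carrier_FactGroup carrier_free_group)

lemma elt_mult:
  "u \<in> words X \<Longrightarrow> v \<in> words X \<Longrightarrow> elt (u @ v) = elt u \<otimes>\<^bsub>presented_group X R\<^esub> elt v"
  by (simp add: presented_group_def pres_elt_def NC.rcos_sum carrier_free_group)

sublocale letters "presented_group X R" "\<lambda>x. elt (gen x)" X
  by (intro letters.intro letters_axioms.intro group_presented) (simp add: presented_carrier)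

lemma elt_winv: "w \<in> words X \<Longrightarrow> elt (winv w) = inv\<^bsub>presented_group X R\<^esub> elt w"
  by (simp add: presented_group_def pres_elt_def NC.inv_FactGroup carrier_FactGroup
      carrier_free_group NC.rcos_inv flip: fclass_winv)

lemma elt_Nil: "elt [] = \<one>\<^bsub>presented_group X R\<^esub>"
  using FG.coset_join2[OF FG.one_closed NC.is_subgroup NC.one_closed]
  by (simp add: presented_group_def pres_elt_def)

lemma value_elt: "w \<in> words X \<Longrightarrow> weval (presented_group X R) (\<lambda>x. elt (gen x)) w = elt w"
  by (induction w rule: words_induct) (simp_all add: elt_Nil elt_mult elt_winv)

lemma rel_holds:
  assumes "(u, v) \<in> R"
  shows "elt u = elt v"
proof -
  have "fclass (u @ winv v) \<in> normal_closure (free_group X) (relators R)"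
    using normal_normal_closure(2)[OF group_free_group relators_closed] assms
    by (auto simp: relators_def)
  then have "elt (u @ winv v) = \<one>\<^bsub>presented_group X R\<^esub>"
    using FG.coset_join2[OF _ NC.is_subgroup] NC.mem_carrier
    by (simp add: presented_group_def pres_elt_def)
  then show ?thesis using rel_words[OF assms]
    by (simp add: elt_mult elt_winv) (metis value_elt value_closed inv_equality inv_inv inv_closed)
qed

text \<open>Von Dyck's theorem: the kernel of the extension to the free group is normal and contains the
  relators, hence their normal closure.\<close>

lemma presented_group_universal:
  assumes "letters H b X" and rels: "\<And>u v. (u, v) \<in> R \<Longrightarrow> weval H b u = weval H b v"
  obtains h where "h \<in> hom (presented_group X R) H"
    "\<And>w. w \<in> words X \<Longrightarrow> h (elt w) = weval H b w"
proof -
  interpret H: letters H b X by fact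
  obtain h where h: "h \<in> hom (free_group X) H" "\<And>w. w \<in> words X \<Longrightarrow> h (fclass w) = weval H b w"
    using H.free_group_universal by blast
  interpret h: group_hom "free_group X" H h by unfold_locales (rule h(1))
  have "relators R \<subseteq> kernel (free_group X) H h"
    using relators_closed rel_words rels by (auto simp: kernel_def relators_def h(2))
  then have "normal_closure (free_group X) (relators R) \<subseteq> kernel (free_group X) H h"
    by (intro normal_closure_minimal h.normal_kernel)
  then obtain k where "k \<in> hom (presented_group X R) H"
    "\<And>x. x \<in> carrier (free_group X) \<Longrightarrow>
       k (normal_closure (free_group X) (relators R) #>\<^bsub>free_group X\<^esub> x) = h x"
    using h.FactGroup_universal_kernel[OF NC.normal_axioms] unfolding presented_group_def by blast
  then show thesis
    using h(2) by (intro that[of k]) (auto simp: pres_elt_def carrier_free_group)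
qed

end


section \<open>Commutator calculus\<close>

context group
begin

lemma gconj_closed [simp]: "x \<in> carrier G \<Longrightarrow> y \<in> carrier G \<Longrightarrow> gconj G y x \<in> carrier G"
  and gcomm_closed [simp]: "x \<in> carrier G \<Longrightarrow> y \<in> carrier G \<Longrightarrow> gcomm G x y \<in> carrier G"
  by (simp_all add: gconj_def gcomm_def)

lemma gconj_one [simp]: "y \<in> carrier G \<Longrightarrow> gconj G y \<one> = y" "x \<in> carrier G \<Longrightarrow> gconj G \<one> x = \<one>"
  by (simp_all add: gconj_def)

lemma gcomm_one [simp]:
  "x \<in> carrier G \<Longrightarrow> gcomm G x \<one> = \<one>" "x \<in> carrier G \<Longrightarrow> gcomm G \<one> x = \<one>"
  "x \<in> carrier G \<Longrightarrow> gcomm G x x = \<one>"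
  by (simp_all add: gcomm_def m_assoc)

lemma gconj_hom: "x \<in> carrier G \<Longrightarrow> (\<lambda>y. gconj G y x) \<in> hom G G"
  by (auto simp: hom_def gconj_def m_assoc)

lemma gconj_mult:
  "\<lbrakk>x \<in> carrier G; y \<in> carrier G; z \<in> carrier G\<rbrakk> \<Longrightarrow>
    gconj G x (y \<otimes> z) = gconj G (gconj G x y) z"
  by (simp add: gconj_def m_assoc inv_mult_group)

lemma gconj_self [simp]: "x \<in> carrier G \<Longrightarrow> gconj G x x = x"
  by (simp add: gconj_def m_assoc)

lemma gconj_eq_iff_commute:
  assumes "x \<in> carrier G" "y \<in> carrier G"
  shows "gconj G y x = y \<longleftrightarrow> y \<otimes> x = x \<otimes> y"
  using assms inv_solve_left'[of y x "y \<otimes> x"] by (simp add: gconj_def m_assoc)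

lemma gcomm_mult_right:
  "\<lbrakk>x \<in> carrier G; y \<in> carrier G; z \<in> carrier G\<rbrakk> \<Longrightarrow>
    gcomm G x (y \<otimes> z) = gcomm G x z \<otimes> gconj G (gcomm G x y) z"
  by (simp add: gcomm_def gconj_def m_assoc inv_mult_group)

lemma gcomm_mult_left:
  "\<lbrakk>x \<in> carrier G; y \<in> carrier G; z \<in> carrier G\<rbrakk> \<Longrightarrow>
    gcomm G (x \<otimes> y) z = gconj G (gcomm G x z) y \<otimes> gcomm G y z"
  by (simp add: gcomm_def gconj_def m_assoc inv_mult_group)

lemma gcomm_eq_one_iff:
  assumes "x \<in> carrier G" "y \<in> carrier G"
  shows "gcomm G x y = \<one> \<longleftrightarrow> x \<otimes> y = y \<otimes> x"
proof -
  have "gcomm G x y = inv (y \<otimes> x) \<otimes> (x \<otimes> y)"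
    using assms by (simp add: gcomm_def inv_mult_group m_assoc)
  then show ?thesis using assms inv_solve_left'[of \<one> "y \<otimes> x" "x \<otimes> y"] by simp
qed

end

lemma (in group_hom) hom_gcomm:
  "x \<in> carrier G \<Longrightarrow> y \<in> carrier G \<Longrightarrow> h (gcomm G x y) = gcomm H (h x) (h y)"
  by (simp add: gcomm_def)

text \<open>The subgroup \<open>Z\<close> of the proof idea above. It is normal in every group \<open>G\<close>, so that dividing by it
  needs no commutator calculation.\<close>

definition central_torsion :: "('a, 'b) monoid_scheme \<Rightarrow> nat \<Rightarrow> 'a set" where
  "central_torsion G q = {z \<in> carrier G. (\<forall>y \<in> carrier G. z \<otimes>\<^bsub>G\<^esub> y = y \<otimes>\<^bsub>G\<^esub> z) \<and> z [^]\<^bsub>G\<^esub> q = \<one>\<^bsub>G\<^esub>}"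

lemma central_torsionD:
  assumes "z \<in> central_torsion G q"
  shows "z \<in> carrier G" and "y \<in> carrier G \<Longrightarrow> z \<otimes>\<^bsub>G\<^esub> y = y \<otimes>\<^bsub>G\<^esub> z" and "z [^]\<^bsub>G\<^esub> q = \<one>\<^bsub>G\<^esub>"
  using assms unfolding central_torsion_def by blast+

lemma central_torsionI:
  assumes "z \<in> carrier G" "\<And>y. y \<in> carrier G \<Longrightarrow> z \<otimes>\<^bsub>G\<^esub> y = y \<otimes>\<^bsub>G\<^esub> z" "z [^]\<^bsub>G\<^esub> q = \<one>\<^bsub>G\<^esub>"
  shows "z \<in> central_torsion G q"
  using assms unfolding central_torsion_def by blast

lemma (in group) normal_central_torsion: "central_torsion G q \<lhd> G"
proof (rule normal_invI)
  show "subgroup (central_torsion G q) G"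
  proof
    fix x y assume x: "x \<in> central_torsion G q" and y: "y \<in> central_torsion G q"
    note [simp] = central_torsionD(1)[OF x] central_torsionD(1)[OF y]
    show "x \<otimes> y \<in> central_torsion G q"
    proof (rule central_torsionI)
      fix a assume [simp]: "a \<in> carrier G"
      have "x \<otimes> y \<otimes> a = x \<otimes> (a \<otimes> y)" using central_torsionD(2)[OF y, of a] by (simp add: m_assoc)
      also have "\<dots> = x \<otimes> a \<otimes> y" by (simp add: m_assoc)
      also have "\<dots> = a \<otimes> (x \<otimes> y)" using central_torsionD(2)[OF x, of a] by (simp add: m_assoc)
      finally show "x \<otimes> y \<otimes> a = a \<otimes> (x \<otimes> y)" .
    next
      have "x \<otimes> y = y \<otimes> x" by (rule central_torsionD(2)[OF x]) simp
      then show "(x \<otimes> y) [^] q = \<one>"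
        using central_torsionD(3)[OF x] central_torsionD(3)[OF y] by (simp add: pow_mult_distrib)
    qed simp
  next
    fix x assume x: "x \<in> central_torsion G q"
    note [simp] = central_torsionD(1)[OF x]
    show "inv x \<in> central_torsion G q"
    proof (rule central_torsionI)
      fix a assume [simp]: "a \<in> carrier G"
      have "inv x \<otimes> a = inv x \<otimes> (a \<otimes> x) \<otimes> inv x" by (simp add: m_assoc)
      also have "a \<otimes> x = x \<otimes> a" using central_torsionD(2)[OF x, of a] by simp
      finally show "inv x \<otimes> a = a \<otimes> inv x" by (simp add: m_assoc)
    qed (simp_all add: nat_pow_inv central_torsionD(3)[OF x])
  qed (auto intro: central_torsionI dest: central_torsionD(1))
next
  fix x h assume x: "x \<in> carrier G" and h: "h \<in> central_torsion G q"
  have "x \<otimes> h \<otimes> inv x = h"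
    using x central_torsionD(1)[OF h] central_torsionD(2)[OF h x, symmetric] by (simp add: m_assoc)
  with h show "x \<otimes> h \<otimes> inv x \<in> central_torsion G q" by simp
qed

section \<open>Groups satisfying the relations of \<open>\<nu>\<^sup>q(G)\<close>\<close>

lemma nu_gens_simps [simp]:
  "El g \<in> nu_gens q G \<longleftrightarrow> g \<in> carrier G"
  "Ph g \<in> nu_gens q G \<longleftrightarrow> g \<in> carrier G"
  "NHat g \<in> nu_gens q G \<longleftrightarrow> 0 < q \<and> g \<in> carrier G"
  by (auto simp: nu_gens_def)

text \<open>Working with an arbitrary group \<open>N\<close> that contains elements satisfying the relations, rather than
  with \<open>\<nu>\<^sup>q(G)\<close> alone, makes the same calculations available in \<open>\<nu>\<^sup>q(G)\<close> and in its quotients.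
  Below, \<open>e g\<close>, \<open>f g\<close> and \<open>c k\<close> are the images of \<open>g\<close>, \<open>g\<^sup>\<phi>\<close> and of the hat of \<open>k\<close>, and
  \<open>t g h\<close> is the image of \<open>[g, h\<^sup>\<phi>]\<close>.\<close>

locale nu_model = letters N b "nu_gens q G" + G: group G
  for q :: nat and G :: "('g, 'h) monoid_scheme" and N (structure) and b +
  assumes relation: "(u, v) \<in> nu_rels q G \<Longrightarrow> weval N b u = weval N b v"
begin

abbreviation "e g \<equiv> b (El g)"
abbreviation "f g \<equiv> b (Ph g)"
abbreviation "c k \<equiv> b (NHat k)"
abbreviation "t g h \<equiv> gcomm N (e g) (f h)"

lemma e_hom: "(\<lambda>g. e g) \<in> hom G N"
  using relation[OF mult_El] by (auto simp: hom_def)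

lemma f_hom: "(\<lambda>g. f g) \<in> hom G N"
  using relation[OF mult_Ph] by (auto simp: hom_def)

sublocale e: group_hom G N "\<lambda>g. e g" by unfold_locales (rule e_hom)
sublocale f: group_hom G N "\<lambda>g. f g" by unfold_locales (rule f_hom)

lemma t_conj_e: "\<lbrakk>g \<in> carrier G; h \<in> carrier G; k \<in> carrier G\<rbrakk> \<Longrightarrow> 
    gconj N (t g h) (e k) = t (gconj G g k) (gconj G h k)"
  using relation[OF comm_conj_El, of g h k] by simp

lemma t_conj_f: "\<lbrakk>g \<in> carrier G; h \<in> carrier G; k \<in> carrier G\<rbrakk> \<Longrightarrow> 
    gconj N (t g h) (f k) = t (gconj G g k) (gconj G h k)"
  using relation[OF comm_conj_Ph, of g h k] by simp

lemma c_conj_e: "\<lbrakk>0 < q; k \<in> carrier G; g \<in> carrier G\<rbrakk> \<Longrightarrow>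
    gconj N (c k) (e g) = c (gconj G k g)"
  using relation[OF hat_conj_El, of g k] by (simp add: gconj_def m_assoc)

lemma c_conj_f: "\<lbrakk>0 < q; k \<in> carrier G; g \<in> carrier G\<rbrakk> \<Longrightarrow>
    gconj N (c k) (f g) = c (gconj G k g)"
  using relation[OF hat_conj_Ph, of g k] by (simp add: gconj_def m_assoc)

lemma t_conj_c: "\<lbrakk>0 < q; g \<in> carrier G; h \<in> carrier G; k \<in> carrier G\<rbrakk> \<Longrightarrow>
    gconj N (t g h) (c k) = t (gconj G g (k [^]\<^bsub>G\<^esub> q)) (gconj G h (k [^]\<^bsub>G\<^esub> q))"
  using relation[OF comm_conj_hat, of g h k] by (simp add: gconj_def m_assoc)

lemma c_comm: "\<lbrakk>0 < q; k \<in> carrier G; k1 \<in> carrier G\<rbrakk> \<Longrightarrow>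
    gcomm N (c k) (c k1) = t (k [^]\<^bsub>G\<^esub> q) (k1 [^]\<^bsub>G\<^esub> q)"
  using relation[OF hat_comm, of k k1] by simp

lemma c_gcomm: "\<lbrakk>0 < q; g \<in> carrier G; h \<in> carrier G\<rbrakk> \<Longrightarrow>
    c (gcomm G g h) = t g h [^] q"
  using relation[OF hat_of_comm, of g h] by simp

lemma t_mult_right: "\<lbrakk>g \<in> carrier G; h \<in> carrier G; k \<in> carrier G\<rbrakk> \<Longrightarrow> 
    t g (h \<otimes>\<^bsub>G\<^esub> k) = t g k \<otimes> t (gconj G g k) (gconj G h k)"
  by (simp add: f.hom_mult gcomm_mult_right flip: t_conj_f)

lemma t_mult_left: "\<lbrakk>g \<in> carrier G; h \<in> carrier G; k \<in> carrier G\<rbrakk> \<Longrightarrow> 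
    t (g \<otimes>\<^bsub>G\<^esub> h) k = t (gconj G g h) (gconj G k h) \<otimes> t h k"
  by (simp add: e.hom_mult gcomm_mult_left flip: t_conj_e)

lemma c_mult:
  assumes "0 < q" and [simp]: "k \<in> carrier G" "k1 \<in> carrier G"
  shows "c (k \<otimes>\<^bsub>G\<^esub> k1) = c k \<otimes> foldr (\<lambda>i y. gconj N (t k (k1 [^]\<^bsub>G\<^esub> (- int i)))
           (e (k [^]\<^bsub>G\<^esub> (q - 1 - i))) \<otimes> y) [1..<q] \<one> \<otimes> c k1"
    (is "_ = _ \<otimes> ?p \<otimes> _")
proof -
  have "inv (c k) \<otimes> (c (k \<otimes>\<^bsub>G\<^esub> k1) \<otimes> inv (c k1)) = ?p"
    using relation[OF hat_mult[OF assms]] assms(1) by (simp add: value_concat)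
  from this[symmetric] show ?thesis using assms(1) by (simp add: m_assoc)
qed


text \<open>For \<open>k = k\<^sub>1 = 1\<close> every commutator in the product formula for hats is trivial, so the hat of \<open>1\<close> is
  idempotent.\<close>

lemma c_one: "0 < q \<Longrightarrow> c \<one>\<^bsub>G\<^esub> = \<one>"
proof -
  assume q: "0 < q"
  have "foldr (\<lambda>i y. gconj N (t \<one>\<^bsub>G\<^esub> (\<one>\<^bsub>G\<^esub> [^]\<^bsub>G\<^esub> (- int i)))
           (e (\<one>\<^bsub>G\<^esub> [^]\<^bsub>G\<^esub> (q - 1 - i))) \<otimes> y) is \<one> = \<one>" for "is"
    by (induction "is") auto
  then show ?thesis
    using c_mult[OF q, of "\<one>\<^bsub>G\<^esub>" "\<one>\<^bsub>G\<^esub>"] q by simp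
qed

text \<open>\<open>[g, g\<^sup>\<phi>]\<close> acts trivially on \<open>[g, k\<^sup>\<phi>]\<close>, because \<open>g\<close> and
  \<open>g\<^sup>\<phi>\<close> act on it in the same way, so that the action of \<open>[g, g\<^sup>\<phi>]\<close> is that of \<open>[g, g] = 1\<close>. Now
  compare the expansions of \<open>[g, (gk)\<^sup>\<phi>]\<close> along \<open>gk = g \<cdot> k\<close> and along \<open>gk = (gkg\<^sup>-\<^sup>1) \<cdot> g\<close>.\<close>

lemma diag_conj_f:
  assumes [simp]: "g \<in> carrier G" "k \<in> carrier G"
  shows "gconj N (t g g) (f k) = t g g"
proof -
  have "gconj N (t g k) (e (inv\<^bsub>G\<^esub> g) \<otimes> f (inv\<^bsub>G\<^esub> g) \<otimes> e g \<otimes> f g) = t g k"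
    by (simp add: gconj_mult t_conj_e t_conj_f del: e.hom_inv f.hom_inv flip: G.gconj_mult)
       (simp add: G.m_assoc)
  then have "gconj N (t g k) (t g g) = t g k"
    by (simp add: gcomm_def)
  then have "t g k \<otimes> t g g = t g g \<otimes> t g k"
    by (simp add: gconj_eq_iff_commute)
  also have "\<dots> = t g ((g \<otimes>\<^bsub>G\<^esub> k \<otimes>\<^bsub>G\<^esub> inv\<^bsub>G\<^esub> g) \<otimes>\<^bsub>G\<^esub> g)"
  proof -
    have "gconj G (g \<otimes>\<^bsub>G\<^esub> k \<otimes>\<^bsub>G\<^esub> inv\<^bsub>G\<^esub> g) g = k" by (simp add: gconj_def G.m_assoc)
    then show ?thesis by (subst t_mult_right) simp_all
  qed
  also have "\<dots> = t g (g \<otimes>\<^bsub>G\<^esub> k)" by (simp add: G.m_assoc)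
  also have "\<dots> = t g k \<otimes> gconj N (t g g) (f k)"
    by (simp add: t_mult_right t_conj_f del: f.hom_mult)
  finally show ?thesis by simp
qed

text \<open>The hat of \<open>k\<close> acts on \<open>[g, g\<^sup>\<phi>]\<close> as \<open>k\<^sup>q\<close> does, hence trivially.\<close>

lemma diag_conj_gen:
  assumes [simp]: "g \<in> carrier G" and x: "x \<in> nu_gens q G"
  shows "gconj N (t g g) (b x) = t g g"
proof (cases x)
  case (NHat k)
  with x have [simp]: "k \<in> carrier G" and "0 < q" by simp_all
  then have "gconj N (t g g) (c k) = gconj N (t g g) (f (k [^]\<^bsub>G\<^esub> q))"
    by (simp add: t_conj_c t_conj_f)
  with NHat show ?thesis by (simp add: diag_conj_f)
qed (use x t_conj_e t_conj_f diag_conj_f in auto)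

lemma diag_conj:
  assumes g: "g \<in> carrier G" and w: "w \<in> words (nu_gens q G)"
  shows "gconj N (t g g) (weval N b w) = t g g"
  using w
proof (induction w rule: words_induct)
  case (pos x w)
  then show ?case by (simp add: gconj_mult g diag_conj_gen)
next
  case (neg x w)
  have "gconj N (t g g) (inv (b x)) = gconj N (gconj N (t g g) (b x)) (inv (b x))"
    using neg by (simp add: g diag_conj_gen)
  also have "\<dots> = t g g" using neg g by (simp flip: gconj_mult)
  finally show ?case using neg g by (simp add: gconj_mult)
qed (simp add: g)

lemma diag_central_torsion:
  assumes g: "g \<in> carrier G" and gen: "carrier N \<subseteq> weval N b ` words (nu_gens q G)"
  shows "t g g \<in> central_torsion N q"
proof (rule central_torsionI)
  show "t g g \<in> carrier N" using g by simp
  show "t g g \<otimes> y = y \<otimes> t g g" if "y \<in> carrier N" for y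
    using that gen diag_conj[OF g] gconj_eq_iff_commute[of y "t g g"] g by auto
  show "t g g [^] q = \<one>"
    using g c_gcomm[of g g] c_one by (cases "q = 0") simp_all
qed

end

section \<open>Homomorphisms out of the \<open>q\<close>-exterior square\<close>

lemma tens_gens_simps [simp]:
  "Tens g h \<in> tens_gens q G \<longleftrightarrow> g \<in> carrier G \<and> h \<in> carrier G"
  "THat g \<in> tens_gens q G \<longleftrightarrow> 0 < q \<and> g \<in> carrier G"
  by (auto simp: tens_gens_def)

lemma (in group) presentation_tens: "presentation (tens_gens q G) (tens_rels q G)"
proof
  show "u \<in> words (tens_gens q G) \<and> v \<in> words (tens_gens q G)" if "(u, v) \<in> tens_rels q G" for u v
    using that by cases (auto intro!: words_concat words_wpow)
qed

lemma (in group) presentation_nu: "presentation (nu_gens q G) (nu_rels q G)"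
proof
  show "u \<in> words (nu_gens q G) \<and> v \<in> words (nu_gens q G)" if "(u, v) \<in> nu_rels q G" for u v
    using that by cases (auto intro!: words_concat words_wpow)
qed

text \<open>The product of the cosets of \<open>x\<close> and \<open>x\<^sup>-\<^sup>1\<close> is a single coset; it contains \<open>1\<close>, so it is \<open>D\<close>,
  and it contains \<open>x D x\<^sup>-\<^sup>1\<close>. Since a presentation of the exterior square includes that
  it is a group, the \<open>g \<otimes> g\<close> generate a normal subgroup of the tensor square.\<close>

lemma normal_if_group_Mod:
  fixes G (structure)
  assumes "group G" "subgroup D G" "group (G Mod D)"
  shows "D \<lhd> G"
proof -
  interpret group G by fact
  interpret D: subgroup D G by fact
  interpret Q: group "G Mod D" by fact
  show ?thesis
  proof (rule normal_invI[OF assms(2)])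
    fix x h assume x: "x \<in> carrier G" and h: "h \<in> D"
    have "(D #> x) <#> (D #> inv x) \<in> carrier (G Mod D)"
      using Q.m_closed[of "D #> x" "D #> inv x"] x by (simp add: carrier_FactGroup)
    then obtain y where y: "y \<in> carrier G" "(D #> x) <#> (D #> inv x) = D #> y"
      by (auto simp: carrier_FactGroup)
    \<comment> \<open>Write \<open>x h' x\<^sup>-\<^sup>1\<close> as the product of \<open>1 x\<close> and \<open>h' x\<^sup>-\<^sup>1\<close>.\<close>
    have mem: "x \<otimes> h' \<otimes> inv x \<in> D #> y" if "h' \<in> D" for h'
    proof -
      have "\<one> \<otimes> x \<in> D #> x" "h' \<otimes> inv x \<in> D #> inv x"
        using that x by (auto simp: r_coset_def)
      then have "(\<one> \<otimes> x) \<otimes> (h' \<otimes> inv x) \<in> D #> y"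
        unfolding y(2)[symmetric] set_mult_def by blast
      then show ?thesis using that x by (simp add: m_assoc D.mem_carrier)
    qed
    have "\<one> \<in> D #> y" using mem[of \<one>] x by simp
    then have "D #> y = D #> \<one>" using repr_independence[OF _ y(1) assms(2)] by simp
    then show "x \<otimes> h \<otimes> inv x \<in> D" using mem[OF h] D.subset by simp
  qed
qed

context
  fixes q :: nat and G :: "('a, 'b) monoid_scheme"
  assumes G: "group G"
begin

interpretation T: presentation "tens_gens q G" "tens_rels q G"
  by (rule group.presentation_tens[OF G])

lemma group_tens_sq: "group (tens_sq q G)"
  unfolding tens_sq_def by (rule T.group_presented)

lemma tens_elt_closed: "s \<in> tens_gens q G \<Longrightarrow> tens_elt q G s \<in> carrier (tens_sq q G)"
  using T.letter_closed by (simp add: tens_sq_def tens_elt_def)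

lemma normal_diag_sub:
  assumes E: "group (ext_sq q G)"
  shows "diag_sub q G \<lhd> tens_sq q G"
proof (rule normal_if_group_Mod[OF group_tens_sq _ E[unfolded ext_sq_def]])
  show "subgroup (diag_sub q G) (tens_sq q G)"
    unfolding diag_sub_def
    by (rule group.generate_is_subgroup[OF group_tens_sq]) (auto intro: tens_elt_closed)
qed

lemma ext_proj_hom:
  assumes "group (ext_sq q G)"
  shows "(\<lambda>x. diag_sub q G #>\<^bsub>tens_sq q G\<^esub> x) \<in> hom (tens_sq q G) (ext_sq q G)"
  unfolding ext_sq_def by (rule normal.r_coset_hom_Mod[OF normal_diag_sub[OF assms]])

lemma ext_sq_letters:
  assumes "group (ext_sq q G)"
  shows "letters (ext_sq q G) (ext_elt q G) (tens_gens q G)"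
  using assms hom_in_carrier[OF ext_proj_hom[OF assms]] tens_elt_closed
  by (intro letters.intro letters_axioms.intro) (auto simp: ext_elt_def)

lemma ext_sq_generated:
  assumes E: "group (ext_sq q G)"
  shows "carrier (ext_sq q G) \<subseteq> weval (ext_sq q G) (ext_elt q G) ` words (tens_gens q G)"
proof
  fix y assume "y \<in> carrier (ext_sq q G)"
  then obtain x where x: "x \<in> carrier (tens_sq q G)" "y = diag_sub q G #>\<^bsub>tens_sq q G\<^esub> x"
    by (auto simp: ext_sq_def carrier_FactGroup)
  then obtain w where w: "w \<in> words (tens_gens q G)" "x = T.elt w"
    unfolding tens_sq_def T.presented_carrier by auto
  have "tens_elt q G = (\<lambda>s. T.elt (gen s))" by (rule ext) (rule tens_elt_def)
  then have "x = weval (tens_sq q G) (tens_elt q G) w"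
    using T.value_elt[OF w(1)] w(2) by (simp add: tens_sq_def)
  moreover have "diag_sub q G #>\<^bsub>tens_sq q G\<^esub> weval (tens_sq q G) (tens_elt q G) w =
      weval (ext_sq q G) (ext_elt q G) w"
    by (rule hom_weval[OF group_tens_sq E ext_proj_hom[OF E] _ _ w(1)])
      (use tens_elt_closed in \<open>auto simp: ext_elt_def\<close>)
  ultimately have "y = weval (ext_sq q G) (ext_elt q G) w" using x(2) by simp
  with w show "y \<in> weval (ext_sq q G) (ext_elt q G) ` words (tens_gens q G)" by blast
qed

end

primrec tens_value :: "('n, 'c) monoid_scheme \<Rightarrow> ('g nu_gen \<Rightarrow> 'n) \<Rightarrow> 'g tens_gen \<Rightarrow> 'n" where
  "tens_value N b (Tens g h) = gcomm N (b (El g)) (b (Ph h))"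
| "tens_value N b (THat k) = b (NHat k)"

context nu_model
begin

sublocale tens: letters N "tens_value N b" "tens_gens q G"
proof
  show "tens_value N b x \<in> carrier N" if "x \<in> tens_gens q G" for x
    using that by (cases x) auto
qed

text \<open>The relations with hats are relations of \<open>\<nu>\<^sup>q(G)\<close> with factors moved to the other side. The two
  others are the commutator identities for \<open>[g, h\<^sup>\<phi> h\<^sub>1\<^sup>\<phi>]\<close> and \<open>[g g\<^sub>1, h\<^sup>\<phi>]\<close>, in which
  conjugation by \<open>h\<^sub>1\<^sup>\<phi>\<close> or by \<open>g\<^sub>1\<close> is carried out on both entries.\<close>

lemma tens_relation:
  assumes "(u, v) \<in> tens_rels q G"
  shows "weval N (tens_value N b) u = weval N (tens_value N b) v"
  using assms
proof (cases rule: tens_rels.cases)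
  case (tens_hat_mult k k1)
  note [simp] = tens_hat_mult(3-5)
  let ?w = "\<lambda>i. gen (tens_act G (k [^]\<^bsub>G\<^esub> (q - 1 - i)) (Tens k (k1 [^]\<^bsub>G\<^esub> (- int i))))"
  have w: "concat (map ?w is) \<in> words (tens_gens q G)" for "is" by (rule words_concat) auto
  have eval: "weval N (tens_value N b) (concat (map ?w is)) =
    foldr (\<lambda>i y. gconj N (t k (k1 [^]\<^bsub>G\<^esub> (- int i))) (e (k [^]\<^bsub>G\<^esub> (q - 1 - i))) \<otimes> y) is \<one>" for "is"
    by (subst tens.value_concat) (simp_all add: t_conj_e)
  have "c (k \<otimes>\<^bsub>G\<^esub> k1) = c k \<otimes> weval N (tens_value N b) (concat (map ?w [1..<q])) \<otimes> c k1"
    unfolding eval by (rule c_mult) (use tens_hat_mult(3) in simp_all)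
  then show ?thesis
    using w[of "[1..<q]"] tens_hat_mult(3) unfolding tens_hat_mult(1,2)
    by (simp add: m_assoc del: tens_act.simps)
qed (simp_all add: t_mult_left t_mult_right t_conj_c c_comm c_gcomm del: e.hom_mult f.hom_mult)

text \<open>On letters, this makes \<open>\<mu>\<close> equivariant for conjugation by \<open>x\<close> and for conjugation by \<open>x\<^sup>\<phi>\<close>.\<close>

lemma tens_value_act:
  assumes "x \<in> carrier G" "s \<in> tens_gens q G"
  shows "tens_value N b (tens_act G x s) = gconj N (tens_value N b s) (e x)"
    and "tens_value N b (tens_act G x s) = gconj N (tens_value N b s) (f x)"
  using assms by (cases s; simp add: t_conj_e t_conj_f c_conj_e c_conj_f)+

lemma tens_act_closed: "x \<in> carrier G \<Longrightarrow> s \<in> tens_gens q G \<Longrightarrow> tens_act G x s \<in> tens_gens q G"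
  by (cases s) auto

lemma ext_sq_universal:
  assumes diag: "\<And>g. g \<in> carrier G \<Longrightarrow> t g g = \<one>" and E: "group (ext_sq q G)"
  obtains \<mu> where "\<mu> \<in> hom (ext_sq q G) N"
    "\<And>s. s \<in> tens_gens q G \<Longrightarrow> \<mu> (ext_elt q G s) = tens_value N b s"
proof -
  interpret T: presentation "tens_gens q G" "tens_rels q G" by (rule G.presentation_tens)
  obtain h where h: "h \<in> hom (tens_sq q G) N"
    "\<And>w. w \<in> words (tens_gens q G) \<Longrightarrow> h (T.elt w) = weval N (tens_value N b) w"
    using T.presented_group_universal[OF tens.letters_axioms tens_relation]
    unfolding tens_sq_def by blast
  interpret h: group_hom "tens_sq q G" N h
    using group_tens_sq[OF G.is_group] h(1) is_group by (intro group_hom.intro group_hom_axioms.intro)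
  have elt: "tens_elt q G s \<in> carrier (tens_sq q G)" "h (tens_elt q G s) = tens_value N b s"
    if "s \<in> tens_gens q G" for s
    using that tens_elt_closed[OF G.is_group that] by (simp_all add: tens_elt_def h(2))
  have "diag_sub q G \<subseteq> kernel (tens_sq q G) N h"
    unfolding diag_sub_def
    by (rule h.G.generate_subgroup_incl[OF _ h.subgroup_kernel])
      (auto simp: kernel_def elt diag)
  then obtain \<mu> where \<mu>: "\<mu> \<in> hom (ext_sq q G) N"
    "\<And>x. x \<in> carrier (tens_sq q G) \<Longrightarrow> \<mu> (diag_sub q G #>\<^bsub>tens_sq q G\<^esub> x) = h x"
    using h.FactGroup_universal_kernel[OF normal_diag_sub[OF G.is_group E]]
    unfolding ext_sq_def by blast
  show thesis
    by (rule that[OF \<mu>(1)]) (simp add: ext_elt_def \<mu>(2) elt)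
qed

end


section \<open>Polycyclic presentations\<close>

lemma words_gen_pow: "x \<in> X \<Longrightarrow> gen_pow x a \<in> words X"
  by (auto simp: gen_pow_def words_def)

lemma words_pc_word: "1 \<le> lo \<Longrightarrow> pc_word lo hi a \<in> words {1..hi}"
  unfolding pc_word_def by (rule words_concat) (auto intro!: words_gen_pow)

lemma presentation_pc:
  assumes "pc_fin P \<subseteq> {1..pc_len P}"
  shows "presentation {1..pc_len P} (pc_rels P)"
proof
  show "u \<in> words {1..pc_len P} \<and> v \<in> words {1..pc_len P}" if "(u, v) \<in> pc_rels P" for u v
    using that assms
    by cases (auto intro!: words_wpow words_pc_word simp del: One_nat_def)
qed

lemma (in presentation) has_presentationD:
  assumes "has_presentation G a X R"
  shows "letters G a X" and "(u, v) \<in> R \<Longrightarrow> weval G a u = weval G a v"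
    and "carrier G \<subseteq> weval G a ` words X"
proof -
  obtain h where G: "group G" and h: "h \<in> iso (presented_group X R) G"
    and ha: "\<And>x. x \<in> X \<Longrightarrow> h (elt (gen x)) = a x"
    using assms unfolding has_presentation_def by blast
  have hom: "h \<in> hom (presented_group X R) G" using h by (simp add: iso_def)
  show "letters G a X"
    using G hom_in_carrier[OF hom] ha letter_closed
    by (intro letters.intro letters_axioms.intro) (auto simp flip: ha)
  have val: "h (elt w) = weval G a w" if "w \<in> words X" for w
    using hom_weval[OF group_presented G hom, of "\<lambda>x. elt (gen x)" X a w] that ha letter_closed
    by (simp add: value_elt image_subset_iff)
  show "weval G a u = weval G a v" if "(u, v) \<in> R"
    using rel_holds[OF that] rel_words[OF that] val by metis
  show "carrier G \<subseteq> weval G a ` words X"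
    using h val by (force simp: iso_iff presented_carrier)
qed

lemma consistent_pc_presentationD:
  assumes "consistent_pc_presentation G g P"
  shows "group G" and "letters G g {1..pc_len P}" and "presentation {1..pc_len P} (pc_rels P)"
    and "(u, v) \<in> pc_rels P \<Longrightarrow> weval G g u = weval G g v"
    and "carrier G \<subseteq> weval G g ` words {1..pc_len P}"
proof -
  show P: "presentation {1..pc_len P} (pc_rels P)"
    using assms by (intro presentation_pc) (simp add: consistent_pc_presentation_def)
  have hp: "has_presentation G g {1..pc_len P} (pc_rels P)"
    using assms by (simp add: consistent_pc_presentation_def)
  note D = presentation.has_presentationD[OF P hp]
  show "group G" "letters G g {1..pc_len P}" "(u, v) \<in> pc_rels P \<Longrightarrow> weval G g u = weval G g v"
    "carrier G \<subseteq> weval G g ` words {1..pc_len P}"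
    using D hp by (simp_all add: has_presentation_def)
qed

lemma weval_hom_comp:
  assumes "letters G a X" "group H" "h \<in> hom G H" "w \<in> words X"
  shows "weval H (h \<circ> a) w = h (weval G a w)"
  using hom_weval[of G H h a X "h \<circ> a" w] assms
  by (simp add: letters_def letters_axioms_def image_subset_iff)

section \<open>From \<open>\<tau>\<^sup>q(G)\<close> back to a quotient of \<open>\<nu>\<^sup>q(G)\<close>\<close>

lemma tau_gens_simps [simp]:
  "TG i \<in> tau_gens P Q \<longleftrightarrow> i \<in> {1..pc_len P}"
  "TPh i \<in> tau_gens P Q \<longleftrightarrow> i \<in> {1..pc_len P}"
  "TW i \<in> tau_gens P Q \<longleftrightarrow> i \<in> {1..pc_len Q}"
  by (auto simp: tau_gens_def)

primrec tau_value ::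
    "('h \<Rightarrow> 'n) \<Rightarrow> ('g nu_gen \<Rightarrow> 'n) \<Rightarrow> (nat \<Rightarrow> 'g) \<Rightarrow> (nat \<Rightarrow> 'h) \<Rightarrow> tau_gen \<Rightarrow> 'n" where
  "tau_value \<mu> b g w (TG i) = b (El (g i))"
| "tau_value \<mu> b g w (TPh i) = b (Ph (g i))"
| "tau_value \<mu> b g w (TW i) = \<mu> (w i)"

locale tau_setting =
  fixes q :: nat and G :: "('a, 'b) monoid_scheme" and g P w Q wd
  assumes pcG: "consistent_pc_presentation G g P"
    and pcE: "consistent_pc_presentation (ext_sq q G) w Q"
    and wd: "\<And>x. x \<in> carrier (ext_sq q G) \<Longrightarrow>
               wd x \<in> words {1..pc_len Q} \<and> weval (ext_sq q G) w (wd x) = x"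
begin

sublocale G: letters G g "{1..pc_len P}" by (rule consistent_pc_presentationD(2)[OF pcG])
sublocale E: letters "ext_sq q G" w "{1..pc_len Q}" by (rule consistent_pc_presentationD(2)[OF pcE])
sublocale X: letters "ext_sq q G" "ext_elt q G" "tens_gens q G"
  by (rule ext_sq_letters[OF G.is_group E.is_group])
sublocale pcG: presentation "{1..pc_len P}" "pc_rels P" by (rule consistent_pc_presentationD(3)[OF pcG])
sublocale pcE: presentation "{1..pc_len Q}" "pc_rels Q" by (rule consistent_pc_presentationD(3)[OF pcE])

lemma ext_hat_zero: "q = 0 \<Longrightarrow> ext_hat q G k = \<one>\<^bsub>ext_sq q G\<^esub>"
  and ext_hat_pos: "0 < q \<Longrightarrow> ext_hat q G k = ext_elt q G (THat k)"
  by (simp_all add: ext_hat_def)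

lemma ext_hat_closed: "k \<in> carrier G \<Longrightarrow> ext_hat q G k \<in> carrier (ext_sq q G)"
  by (metis E.one_closed X.letter_closed ext_hat_pos ext_hat_zero gr0I tens_gens_simps(2))

lemma lam_closed: "\<lbrakk>x \<in> carrier G; y \<in> carrier G; z \<in> carrier G\<rbrakk> \<Longrightarrow> lam q G x y z \<in> carrier (ext_sq q G)"
  using ext_hat_closed by (simp add: lam_def wedge_def)

text \<open>The action is defined by choosing a word for its argument. All that is used below is that the value
  comes from some such word; since \<open>\<mu>\<close> sends the letters acted upon to conjugates, the choice
  disappears after applying \<open>\<mu>\<close>.\<close>

lemma ext_act_word:
  assumes "y \<in> carrier (ext_sq q G)"
  obtains u where "u \<in> words (tens_gens q G)" "weval (ext_sq q G) (ext_elt q G) u = y"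
    "ext_act q G x y = weval (ext_sq q G) (\<lambda>s. ext_elt q G (tens_act G x s)) u"
proof -
  have "\<exists>u. u \<in> words (tens_gens q G) \<and> weval (ext_sq q G) (ext_elt q G) u = y"
    using assms ext_sq_generated[OF G.is_group E.is_group] by auto
  from someI_ex[OF this] show thesis
    using that unfolding ext_act_def hom_on_gens_def by blast
qed

lemma ext_act_closed:
  assumes x: "x \<in> carrier G" and y: "y \<in> carrier (ext_sq q G)"
  shows "ext_act q G x y \<in> carrier (ext_sq q G)"
proof -
  have act: "tens_act G x s \<in> tens_gens q G" if "s \<in> tens_gens q G" for s
    using x that by (cases s) auto
  obtain u where u: "u \<in> words (tens_gens q G)"
    "ext_act q G x y = weval (ext_sq q G) (\<lambda>s. ext_elt q G (tens_act G x s)) u"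
    using ext_act_word[OF y] by metis
  then show ?thesis using act
    by (auto intro!: weval_closed[OF E.is_group, where X = "tens_gens q G"])
qed

lemma presentation_tau: "presentation (tau_gens P Q) (tau_rels q G g P w Q wd)"
proof
  have w: "wsubst TW (wd y) \<in> words (tau_gens P Q)" if "y \<in> carrier (ext_sq q G)" for y
    using wd[OF that] by (auto intro!: words_wsubst)
  have s: "wsubst TG u \<in> words (tau_gens P Q)" "wsubst TPh u \<in> words (tau_gens P Q)"
    if "u \<in> words {1..pc_len P}" for u
    using that by (auto intro!: words_wsubst)
  have sw: "wsubst TW u \<in> words (tau_gens P Q)" if "u \<in> words {1..pc_len Q}" for u
    using that by (auto intro!: words_wsubst)
  show "u \<in> words (tau_gens P Q) \<and> v \<in> words (tau_gens P Q)"
    if "(u, v) \<in> tau_rels q G g P w Q wd" for u v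
    using that by cases
      (auto simp: s sw pcG.rel_words pcE.rel_words intro!: w lam_closed ext_act_closed
       dest: pcG.rel_words pcE.rel_words)
qed

end

text \<open>The intended \<open>N\<close> is the quotient of \<open>\<nu>\<^sup>q(G)\<close> by its central elements of order dividing \<open>q\<close>, and
  \<open>\<mu>\<close> the map that it receives from the exterior square.\<close>

locale tau_target = tau_setting q G g P w Q wd + N: nu_model q G N b
  for q G g P w Q wd N b +
  fixes \<mu>
  assumes mu_hom: "\<mu> \<in> hom (ext_sq q G) N"
    and mu_elt: "s \<in> tens_gens q G \<Longrightarrow> \<mu> (ext_elt q G s) = tens_value N b s"
begin

sublocale mu: group_hom "ext_sq q G" N \<mu> by unfold_locales (rule mu_hom)

lemma mu_lam:
  assumes "x \<in> carrier G" "y \<in> carrier G" "k \<in> carrier G"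
  shows "\<mu> (lam q G x y k) = N.t x y \<otimes>\<^bsub>N\<^esub> (if q = 0 then \<one>\<^bsub>N\<^esub> else N.c k)"
proof -
  have "\<mu> (ext_hat q G k) = (if q = 0 then \<one>\<^bsub>N\<^esub> else N.c k)"
  proof (cases "q = 0")
    case True
    show ?thesis unfolding ext_hat_zero[OF True] mu.hom_one using True by simp
  next
    case False
    then show ?thesis using assms by (simp add: ext_hat_pos mu_elt)
  qed
  then show ?thesis
    using assms by (simp add: lam_def wedge_def mu_elt ext_hat_closed)
qed

lemma mu_lam_one: "x \<in> carrier G \<Longrightarrow> y \<in> carrier G \<Longrightarrow> \<mu> (lam q G x y \<one>\<^bsub>G\<^esub>) = N.t x y"
  by (simp add: mu_lam N.c_one)

lemma mu_act:
  assumes x: "x \<in> carrier G" and y: "y \<in> carrier (ext_sq q G)"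
  shows "\<mu> (ext_act q G x y) = gconj N (\<mu> y) (N.e x)"
    and "\<mu> (ext_act q G x y) = gconj N (\<mu> y) (N.f x)"
proof -
  obtain u where u: "u \<in> words (tens_gens q G)" "weval (ext_sq q G) (ext_elt q G) u = y"
    "ext_act q G x y = weval (ext_sq q G) (\<lambda>s. ext_elt q G (tens_act G x s)) u"
    using ext_act_word[OF y] by metis
  have L: "letters (ext_sq q G) (\<lambda>s. ext_elt q G (tens_act G x s)) (tens_gens q G)"
    using x by unfold_locales (simp add: N.tens_act_closed)
  have act: "\<mu> (ext_act q G x y) = weval N (\<lambda>s. tens_value N b (tens_act G x s)) u"
    unfolding u(3) weval_hom_comp[OF L N.is_group mu_hom u(1), symmetric]
    by (rule weval_cong[OF u(1)]) (simp add: mu_elt N.tens_act_closed x)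
  have y: "\<mu> y = weval N (tens_value N b) u"
    unfolding u(2)[symmetric] weval_hom_comp[OF X.letters_axioms N.is_group mu_hom u(1), symmetric]
    by (rule weval_cong[OF u(1)]) (simp add: mu_elt)
  have conj: "weval N (\<lambda>s. tens_value N b (tens_act G x s)) u = gconj N (\<mu> y) a"
    if "a \<in> carrier N" "\<And>s. s \<in> tens_gens q G \<Longrightarrow>
        tens_value N b (tens_act G x s) = gconj N (tens_value N b s) a" for a
    unfolding y weval_hom_comp[OF N.tens.letters_axioms N.is_group N.gconj_hom[OF that(1)] u(1), symmetric]
    by (rule weval_cong[OF u(1)]) (simp add: that(2))
  show "\<mu> (ext_act q G x y) = gconj N (\<mu> y) (N.e x)" "\<mu> (ext_act q G x y) = gconj N (\<mu> y) (N.f x)"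
    unfolding act using x by (auto intro!: conj simp: N.tens_value_act(1)) (simp flip: N.tens_value_act)
qed

sublocale tau: letters N "tau_value \<mu> b g w" "tau_gens P Q"
proof
  show "tau_value \<mu> b g w x \<in> carrier N" if "x \<in> tau_gens P Q" for x
    using that by (cases x) auto
qed

lemma tau_value_wsubst:
  "u \<in> words {1..pc_len P} \<Longrightarrow> weval N (tau_value \<mu> b g w) (wsubst TG u) = N.e (weval G g u)"
  "u \<in> words {1..pc_len P} \<Longrightarrow> weval N (tau_value \<mu> b g w) (wsubst TPh u) = N.f (weval G g u)"
  "v \<in> words {1..pc_len Q} \<Longrightarrow> weval N (tau_value \<mu> b g w) (wsubst TW v) = \<mu> (weval (ext_sq q G) w v)"
  using weval_hom_comp[OF G.letters_axioms N.is_group N.e_hom, of u]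
    weval_hom_comp[OF G.letters_axioms N.is_group N.f_hom, of u]
    weval_hom_comp[OF E.letters_axioms N.is_group mu_hom, of v]
  by (simp_all add: weval_wsubst comp_def)

lemma tau_value_wd:
  "y \<in> carrier (ext_sq q G) \<Longrightarrow> weval N (tau_value \<mu> b g w) (wsubst TW (wd y)) = \<mu> y"
  using wd[of y] by (simp add: tau_value_wsubst)

lemma tau_words_wd: "y \<in> carrier (ext_sq q G) \<Longrightarrow> wsubst TW (wd y) \<in> words (tau_gens P Q)"
  using wd[of y] by (auto intro!: words_wsubst)

text \<open>Each relation reads off an identity in \<open>N\<close>. For instance
  \<open>g\<^sub>i\<^sup>-\<^sup>1 g\<^sub>j\<^sup>\<phi> g\<^sub>i = g\<^sub>j\<^sup>\<phi> (g\<^sub>i \<and> g\<^sub>j)\<^sup>-\<^sup>1\<close> holds because \<open>\<mu> (g\<^sub>i \<and> g\<^sub>j) = [g\<^sub>i, g\<^sub>j\<^sup>\<phi>]\<close>, and the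
  hat of \<open>1\<close> in \<open>(g\<^sub>i, g\<^sub>j, 1)\<lambda>\<close> contributes nothing.\<close>

lemma tau_relation:
  assumes "(u, v) \<in> tau_rels q G g P w Q wd"
  shows "weval N (tau_value \<mu> b g w) u = weval N (tau_value \<mu> b g w) v"
  using assms
proof cases
  case (rel_G u' v')
  then show ?thesis
    using pcG.rel_words consistent_pc_presentationD(4)[OF pcG] by (simp add: tau_value_wsubst)
next
  case (rel_Gphi u' v')
  then show ?thesis
    using pcG.rel_words consistent_pc_presentationD(4)[OF pcG] by (simp add: tau_value_wsubst)
next
  case (rel_ext u' v')
  then show ?thesis
    using pcE.rel_words consistent_pc_presentationD(4)[OF pcE] by (simp add: tau_value_wsubst)
next
  case (conj_Gphi i j)
  then show ?thesis
    by (simp add: tau_value_wd tau_words_wd lam_closed mu_lam_one gcomm_def N.inv_mult_group N.m_assoc)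
next
  case (conj_Gphi_inv i j)
  then show ?thesis
    by (simp add: tau_value_wd tau_words_wd lam_closed mu_lam_one gcomm_def N.inv_mult_group N.m_assoc)
next
  case (conj_ext_G i j)
  then show ?thesis
    by (simp add: tau_value_wd tau_words_wd ext_act_closed mu_act(1) gconj_def N.m_assoc)
next
  case (conj_ext_Gphi i j)
  then show ?thesis
    by (simp add: tau_value_wd tau_words_wd ext_act_closed mu_act(2) gconj_def N.m_assoc)
next
  case (conj_ext_G_inv i j)
  then show ?thesis
    by (simp add: tau_value_wd tau_words_wd ext_act_closed mu_act(1) gconj_def N.m_assoc)
next
  case (conj_ext_Gphi_inv i j)
  then show ?thesis
    by (simp add: tau_value_wd tau_words_wd ext_act_closed mu_act(2) gconj_def N.m_assoc)
qed

lemma tau_hom: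
  obtains \<chi> where "\<chi> \<in> hom (tau q G g P w Q wd) N"
    "\<And>u. u \<in> words (tau_gens P Q) \<Longrightarrow>
      \<chi> (tau_elt q G g P w Q wd u) = weval N (tau_value \<mu> b g w) u"
  using presentation.presented_group_universal[OF presentation_tau tau.letters_axioms tau_relation]
  unfolding tau_def tau_elt_def by blast

end

lemma hom_eq_on_values:
  assumes "letters G a X" "group H" "h \<in> hom G H" "k \<in> hom G H"
    and "carrier G \<subseteq> weval G a ` words X" "\<And>x. x \<in> X \<Longrightarrow> h (a x) = k (a x)"
    and "y \<in> carrier G"
  shows "h y = k y"
proof -
  obtain u where u: "u \<in> words X" "y = weval G a u" using assms(5,7) by blast
  have "weval H (h \<circ> a) u = weval H (k \<circ> a) u"
    by (rule weval_cong[OF u(1)]) (simp add: assms(6))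
  then show ?thesis
    using u(2) weval_hom_comp[OF assms(1,2,3) u(1)] weval_hom_comp[OF assms(1,2,4) u(1)] by simp
qed

text \<open>Let \<open>M\<close> be \<open>\<nu>\<^sup>q(G)\<close> modulo its central elements of order dividing \<open>q\<close>, with projection \<open>\<pi>\<close>. In \<open>M\<close>
  all \<open>[g, g\<^sup>\<phi>]\<close> vanish, which is what the exterior square needs in order to map to \<open>M\<close>; then
  \<open>\<chi>\<close> from \<open>\<tau>\<^sup>q(G)\<close> to \<open>M\<close> satisfies \<open>\<chi> \<circ> \<psi> = \<pi>\<close>, and the kernel of \<open>\<psi>\<close> lies in that of \<open>\<pi>\<close>.\<close>

lemma kernel_central_torsion:
  assumes pcG: "consistent_pc_presentation G g P"
    and pcE: "consistent_pc_presentation (ext_sq q G) w Q"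
    and wd: "\<And>x. x \<in> carrier (ext_sq q G) \<Longrightarrow>
               wd x \<in> words {1..pc_len Q} \<and> weval (ext_sq q G) w (wd x) = x"
    and \<psi>: "\<psi> \<in> hom (nu q G) (tau q G g P w Q wd)"
    and \<psi>_g: "\<And>i. i \<in> {1..pc_len P} \<Longrightarrow>
               \<psi> (nu_elt q G (El (g i))) = tau_elt q G g P w Q wd (gen (TG i))"
    and \<psi>_gphi: "\<And>i. i \<in> {1..pc_len P} \<Longrightarrow>
               \<psi> (nu_elt q G (Ph (g i))) = tau_elt q G g P w Q wd (gen (TPh i))"
    and \<psi>_hat: "\<And>k. 0 < q \<Longrightarrow> k \<in> carrier G \<Longrightarrow>
               \<psi> (nu_elt q G (NHat k)) =
                 tau_elt q G g P w Q wd (wsubst TW (wd (lam q G \<one>\<^bsub>G\<^esub> \<one>\<^bsub>G\<^esub> k)))"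
  shows "group (nu q G)" and "group (tau q G g P w Q wd)"
    and "kernel (nu q G) (tau q G g P w Q wd) \<psi> \<subseteq> central_torsion (nu q G) q"
proof -
  let ?T = "tau q G g P w Q wd" and ?Z = "central_torsion (nu q G) q"
  have G: "group G" by (rule consistent_pc_presentationD(1)[OF pcG])
  have E: "group (ext_sq q G)" by (rule consistent_pc_presentationD(1)[OF pcE])
  interpret V: presentation "nu_gens q G" "nu_rels q G" by (rule group.presentation_nu[OF G])
  have nu_elt: "nu_elt q G = (\<lambda>x. V.elt (gen x))" by (rule ext) (rule nu_elt_def)
  have letters: "letters (nu q G) (nu_elt q G) (nu_gens q G)"
    unfolding nu_def nu_elt by (rule V.letters_axioms)
  have val: "weval (nu q G) (nu_elt q G) u = V.elt u" if "u \<in> words (nu_gens q G)" for u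
    using V.value_elt[OF that] by (simp add: nu_def nu_elt)
  have gen: "carrier (nu q G) \<subseteq> weval (nu q G) (nu_elt q G) ` words (nu_gens q G)"
    using val by (auto simp: nu_def V.presented_carrier)
  have nu_rel: "weval (nu q G) (nu_elt q G) u = weval (nu q G) (nu_elt q G) v"
    if "(u, v) \<in> nu_rels q G" for u v
    using V.rel_holds[OF that] V.rel_words[OF that] by (simp add: val)
  interpret V: nu_model q G "nu q G" "nu_elt q G"
    by (intro nu_model.intro letters G nu_model_axioms.intro nu_rel)
  show "group (nu q G)" by (rule V.is_group)
  define M where "M = nu q G Mod ?Z"
  define \<pi> where "\<pi> y = ?Z #>\<^bsub>nu q G\<^esub> y" for y
  have Z: "?Z \<lhd> nu q G" by (rule V.normal_central_torsion)
  have M: "group M" unfolding M_def by (rule normal.factorgroup_is_group[OF Z])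
  have \<pi>: "\<pi> \<in> hom (nu q G) M"
    using normal.r_coset_hom_Mod[OF Z] by (simp add: M_def \<pi>_def[abs_def])
  interpret \<pi>: group_hom "nu q G" M \<pi>
    using M \<pi> by (intro group_hom.intro group_hom_axioms.intro V.is_group)
  have \<pi>_one: "\<pi> y = \<one>\<^bsub>M\<^esub> \<longleftrightarrow> y \<in> ?Z" if "y \<in> carrier (nu q G)" for y
    using that V.coset_join1[of ?Z y] V.coset_join2[of y ?Z] normal_imp_subgroup[OF Z]
    by (auto simp: \<pi>_def M_def subgroup.subset)
  let ?b = "\<pi> \<circ> nu_elt q G"
  interpret M: nu_model q G M ?b
  proof (intro nu_model.intro letters.intro letters_axioms.intro M G nu_model_axioms.intro)
    show "?b x \<in> carrier M" if "x \<in> nu_gens q G" for x using that by simp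
    show "weval M ?b u = weval M ?b v" if "(u, v) \<in> nu_rels q G" for u v
      using nu_rel[OF that] V.rel_words[OF that] weval_hom_comp[OF letters M \<pi>] by metis
  qed
  have diag: "gcomm M (?b (El x)) (?b (Ph x)) = \<one>\<^bsub>M\<^esub>" if "x \<in> carrier G" for x
    using V.diag_central_torsion[OF that gen] that by (simp add: \<pi>_one flip: \<pi>.hom_gcomm)
  obtain \<mu> where \<mu>: "\<mu> \<in> hom (ext_sq q G) M"
    "\<And>s. s \<in> tens_gens q G \<Longrightarrow> \<mu> (ext_elt q G s) = tens_value M ?b s"
    using M.ext_sq_universal[OF diag E] by blast
  interpret R: tau_target q G g P w Q wd M ?b \<mu>
    by (intro tau_target.intro tau_setting.intro tau_target_axioms.intro
        pcG pcE wd \<mu> M.nu_model_axioms)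
  interpret P: presentation "tau_gens P Q" "tau_rels q G g P w Q wd" by (rule R.presentation_tau)
  show T: "group ?T" unfolding tau_def by (rule P.group_presented)
  obtain \<chi> where \<chi>: "\<chi> \<in> hom ?T M"
    "\<And>u. u \<in> words (tau_gens P Q) \<Longrightarrow> \<chi> (tau_elt q G g P w Q wd u) = weval M (tau_value \<mu> ?b g w) u"
    using R.tau_hom by blast
  have \<chi>\<psi>: "\<chi> \<circ> \<psi> \<in> hom (nu q G) M" by (rule hom_compose[OF \<psi> \<chi>(1)])
  note G_gens = R.G.letters_axioms consistent_pc_presentationD(5)[OF pcG]
  \<comment> \<open>\<open>\<psi>\<close> is prescribed only on the polycyclic generators of \<open>G\<close>; both sides are homomorphic in \<open>x\<close>.\<close>
  have El: "(\<chi> \<circ> \<psi>) (nu_elt q G (El x)) = \<pi> (nu_elt q G (El x))" if "x \<in> carrier G" for x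
  proof (rule hom_eq_on_values[OF G_gens(1) M _ _ G_gens(2) _ that])
    show "(\<lambda>x. (\<chi> \<circ> \<psi>) (nu_elt q G (El x))) \<in> hom G M"
      using hom_compose[OF V.e_hom \<chi>\<psi>] by (simp add: comp_def)
    show "(\<lambda>x. \<pi> (nu_elt q G (El x))) \<in> hom G M" using M.e_hom by simp
    show "(\<chi> \<circ> \<psi>) (nu_elt q G (El (g i))) = \<pi> (nu_elt q G (El (g i)))" if "i \<in> {1..pc_len P}" for i
      using that \<psi>_g[OF that] \<chi>(2)[of "gen (TG i)"] by simp
  qed
  have Ph: "(\<chi> \<circ> \<psi>) (nu_elt q G (Ph x)) = \<pi> (nu_elt q G (Ph x))" if "x \<in> carrier G" for x
  proof (rule hom_eq_on_values[OF G_gens(1) M _ _ G_gens(2) _ that])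
    show "(\<lambda>x. (\<chi> \<circ> \<psi>) (nu_elt q G (Ph x))) \<in> hom G M"
      using hom_compose[OF V.f_hom \<chi>\<psi>] by (simp add: comp_def)
    show "(\<lambda>x. \<pi> (nu_elt q G (Ph x))) \<in> hom G M" using M.f_hom by simp
    show "(\<chi> \<circ> \<psi>) (nu_elt q G (Ph (g i))) = \<pi> (nu_elt q G (Ph (g i)))" if "i \<in> {1..pc_len P}" for i
      using that \<psi>_gphi[OF that] \<chi>(2)[of "gen (TPh i)"] by simp
  qed
  have Hat: "(\<chi> \<circ> \<psi>) (nu_elt q G (NHat k)) = \<pi> (nu_elt q G (NHat k))"
    if k: "0 < q" "k \<in> carrier G" for k
  proof -
    let ?l = "lam q G \<one>\<^bsub>G\<^esub> \<one>\<^bsub>G\<^esub> k"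
    have l: "?l \<in> carrier (ext_sq q G)" using k by (intro R.lam_closed) simp_all
    have "(\<chi> \<circ> \<psi>) (nu_elt q G (NHat k)) = \<mu> ?l"
      using \<psi>_hat[OF k] \<chi>(2)[OF R.tau_words_wd[OF l]] R.tau_value_wd[OF l] by simp
    also have "\<dots> = \<pi> (nu_elt q G (NHat k))" using k diag[of "\<one>\<^bsub>G\<^esub>"] by (subst R.mu_lam) simp_all
    finally show ?thesis .
  qed
  have agree: "(\<chi> \<circ> \<psi>) y = \<pi> y" if "y \<in> carrier (nu q G)" for y
  proof (rule hom_eq_on_values[OF letters M \<chi>\<psi> \<pi> gen _ that])
    show "(\<chi> \<circ> \<psi>) (nu_elt q G x) = \<pi> (nu_elt q G x)" if "x \<in> nu_gens q G" for x
      using that El Ph Hat by (cases x) simp_all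
  qed
  interpret \<chi>: group_hom ?T M \<chi>
    using T M \<chi>(1) by (intro group_hom.intro group_hom_axioms.intro)
  show "kernel (nu q G) ?T \<psi> \<subseteq> ?Z"
  proof
    fix y assume "y \<in> kernel (nu q G) ?T \<psi>"
    then have y: "y \<in> carrier (nu q G)" "\<psi> y = \<one>\<^bsub>?T\<^esub>" by (simp_all add: kernel_def)
    then have "\<pi> y = \<one>\<^bsub>M\<^esub>" using agree[OF y(1)] by simp
    then show "y \<in> ?Z" using \<pi>_one[OF y(1)] by simp
  qed
qed

section \<open>The construction \<open>\<EE>\<^sup>q\<close> for a central kernel of exponent \<open>q\<close>\<close>

lemma (in group) set_mult_subgroup_absorb:
  assumes "subgroup S G" "A \<subseteq> S" "\<one> \<in> A"
  shows "A <#> S = S"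
proof
  show "A <#> S \<subseteq> S" using assms by (auto simp: set_mult_def subgroup.m_closed subset_iff)
  show "S \<subseteq> A <#> S"
  proof
    fix s assume "s \<in> S"
    then have "\<one> \<otimes> s \<in> A <#> S" unfolding set_mult_def using assms(3) by blast
    then show "s \<in> A <#> S" using \<open>s \<in> S\<close> subgroup.mem_carrier[OF assms(1)] by simp
  qed
qed

text \<open>Pulled back along \<open>F \<rightarrow> F/S \<cong> H\<close>, a central kernel of exponent dividing \<open>q\<close> says that \<open>K\<^sup>q\<close> and
  \<open>[K, F]\<close> are contained in \<open>S\<close>, so that multiplying \<open>S\<close> by them changes nothing.\<close>

lemma frakE_eq_Mod:
  assumes S: "S \<lhd> F" and H: "group H" and \<theta>: "\<theta> \<in> iso (F Mod S) H"
    and \<psi>: "kernel H T \<psi> \<subseteq> central_torsion H q"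
  shows "frakE q F S T (\<psi> \<circ> \<theta>) = F Mod S"
proof -
  interpret F: group F using S by (simp add: normal_def)
  interpret S: normal S F by (rule S)
  let ?K = "ker_preimage F S T (\<psi> \<circ> \<theta>)"
  define p where "p x = \<theta> (S #>\<^bsub>F\<^esub> x)" for x
  have "p = \<theta> \<circ> (\<lambda>x. S #>\<^bsub>F\<^esub> x)" by (simp add: p_def fun_eq_iff)
  then have "p \<in> hom F H"
    using hom_compose[OF S.r_coset_hom_Mod iso_imp_homomorphism[OF \<theta>]] by simp
  then interpret p: group_hom F H p
    using H by (intro group_hom.intro group_hom_axioms.intro F.is_group)
  interpret FS: group "F Mod S" by (rule S.factorgroup_is_group)
  have p_one: "x \<in> S" if x: "x \<in> carrier F" "p x = \<one>\<^bsub>H\<^esub>" for x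
  proof -
    have "\<theta> (S #>\<^bsub>F\<^esub> x) = \<theta> \<one>\<^bsub>F Mod S\<^esub>"
      using x(2) hom_one[OF iso_imp_homomorphism[OF \<theta>] FS.is_group H] by (simp add: p_def)
    then have "S #>\<^bsub>F\<^esub> x = \<one>\<^bsub>F Mod S\<^esub>"
      using \<theta> x(1) FS.one_closed by (auto simp: iso_iff carrier_FactGroup dest: inj_onD)
    then show ?thesis using F.coset_join1[OF _ x(1) S.is_subgroup] by simp
  qed
  have K: "x \<in> carrier F" "p x \<in> central_torsion H q" if "x \<in> ?K" for x
  proof -
    show x: "x \<in> carrier F" using that by (simp add: ker_preimage_def)
    have "p x \<in> kernel H T \<psi>"
      using that p.hom_closed[OF x] by (simp add: ker_preimage_def kernel_def p_def)
    then show "p x \<in> central_torsion H q" using \<psi> by blast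
  qed
  have pow: "power_subgroup F q ?K \<subseteq> S"
    unfolding power_subgroup_def
  proof (rule F.generate_subgroup_incl[OF _ S.is_subgroup], rule image_subsetI)
    fix x assume x: "x \<in> ?K"
    then show "x [^]\<^bsub>F\<^esub> q \<in> S"
      using K(1)[OF x] central_torsionD(3)[OF K(2)[OF x]] by (intro p_one) (simp_all add: p.hom_nat_pow)
  qed
  have comm: "comm_subgroup F ?K (carrier F) \<subseteq> S"
    unfolding comm_subgroup_def
  proof (rule F.generate_subgroup_incl[OF _ S.is_subgroup], safe)
    fix x y assume x: "x \<in> ?K" and y: "y \<in> carrier F"
    have "gcomm H (p x) (p y) = \<one>\<^bsub>H\<^esub>"
      using central_torsionD(2)[OF K(2)[OF x]] K(1)[OF x] y by (simp add: p.H.gcomm_eq_one_iff)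
    then show "gcomm F x y \<in> S" using K(1)[OF x] y by (intro p_one) (simp_all add: p.hom_gcomm)
  qed
  have "comm_subgroup F ?K (carrier F) <#>\<^bsub>F\<^esub> S = S" "power_subgroup F q ?K <#>\<^bsub>F\<^esub> S = S"
    using F.set_mult_subgroup_absorb[OF S.is_subgroup comm]
      F.set_mult_subgroup_absorb[OF S.is_subgroup pow]
    by (simp_all add: power_subgroup_def comm_subgroup_def generate.one)
  moreover have "power_subgroup F q ?K <#>\<^bsub>F\<^esub> comm_subgroup F ?K (carrier F) <#>\<^bsub>F\<^esub> S =
      power_subgroup F q ?K <#>\<^bsub>F\<^esub> (comm_subgroup F ?K (carrier F) <#>\<^bsub>F\<^esub> S)"
    using pow comm S.subset by (intro F.set_mult_assoc) auto
  ultimately show ?thesis by (simp add: frakE_def Let_def)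
qed

theorem theorem7p1:
  fixes q m :: nat
    and G :: "('a, 'b) monoid_scheme"
    and g :: "nat \<Rightarrow> 'a"
    and w :: "nat \<Rightarrow> 'a tens_gen gword set set set"
    and P Q :: pc_pres
    and wd :: "'a tens_gen gword set set set \<Rightarrow> nat gword"
    and R S :: "nat gword set set"
    and \<theta> :: "nat gword set set \<Rightarrow> 'a nu_gen gword set set"
    and \<psi> :: "'a nu_gen gword set set \<Rightarrow> tau_gen gword set set"
  defines "F \<equiv> free_group {1..m}"
    and "T \<equiv> tau q G g P w Q wd"
  assumes pcG: "consistent_pc_presentation G g P"
    and pcE: "consistent_pc_presentation (ext_sq q G) w Q"
    and wd: "\<And>x. x \<in> carrier (ext_sq q G) \<Longrightarrow>
               wd x \<in> words {1..pc_len Q} \<and> weval (ext_sq q G) w (wd x) = x"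
    and R: "finite R" "R \<subseteq> carrier F"
    and S: "S = normal_closure F R"
    and \<theta>: "\<theta> \<in> iso (F Mod S) (nu q G)"
    and \<psi>: "\<psi> \<in> epi (nu q G) T"
    and \<psi>_g: "\<And>i. i \<in> {1..pc_len P} \<Longrightarrow>
               \<psi> (nu_elt q G (El (g i))) = tau_elt q G g P w Q wd (gen (TG i))"
    and \<psi>_gphi: "\<And>i. i \<in> {1..pc_len P} \<Longrightarrow>
               \<psi> (nu_elt q G (Ph (g i))) = tau_elt q G g P w Q wd (gen (TPh i))"
    and \<psi>_hat: "\<And>k. 0 < q \<Longrightarrow> k \<in> carrier G \<Longrightarrow>
               \<psi> (nu_elt q G (NHat k)) =
                 tau_elt q G g P w Q wd (wsubst TW (wd (lam q G \<one>\<^bsub>G\<^esub> \<one>\<^bsub>G\<^esub> k)))"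
  shows "frakE q F S T (\<psi> \<circ> \<theta>) = F Mod S"
proof -
  have "S \<lhd> F"
    unfolding S F_def using R(2) by (intro normal_normal_closure(1) group_free_group) (simp add: F_def)
  moreover have "\<psi> \<in> hom (nu q G) T" using \<psi> by (simp add: epi_def)
  note ker = kernel_central_torsion[OF pcG pcE wd this[unfolded T_def] \<psi>_g \<psi>_gphi \<psi>_hat]
  moreover note \<theta>
  ultimately show ?thesis unfolding T_def by (intro frakE_eq_Mod)
qed

end
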